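(* Suppose that $0<s<\infty$ and $1\le p<\infty$ and let $g$ be an analytic function in $\mathbb{D}$. Then the following conditions are equivalent: (i) $M_g$ maps $Q_s$ into $B^p$. (ii) $g\equiv0$.
   Context: $\mathbb{D}$ is the open unit disc in $\mathbb{C}$ and $dA$ is the normalized Lebesgue area measure on $\mathbb{D}$. For $a\in\mathbb{D}$, $\varphi_a(z)=\frac{a-z}{1-\overline{a}z}$. Besov spaces: for $1<p<\infty$, $B^p$ is the space of all analytic $f$ in $\mathbb{D}$ with $\int_{\mathbb{D}}(1-|z|)^{p-2}|f'(z)|^p\,dA(z)<\infty$; $B^1$ is the space of all analytic $f$ in $\mathbb{D}$ with $\int_{\mathbb{D}}|f''(z)|\,dA(z)<\infty$. For $0<s<\infty$, $Q_s$ is the space of all analytic $f$ in $\mathbb{D}$ with $\sup_{a\in\mathbb{D}}\int_{\mathbb{D}}|f'(z)|^2 g(z,a)^s\,dA(z)<\infty$, where $g(z,a)=\log\frac{|1-\overline{a}z|}{|a-z|}$ is the Green function; equivalently (a known fact), $\sup_{a\in\mathbb{D}}\int_{\mathbb{D}}|f'(z)|^2(1-|\varphi_a(z)|^2)^s\,dA(z)<\infty$. $M_g(f)(z)=g(z)f(z)$ for $f$ analytic in $\mathbb{D}$, $z\in\mathbb{D}$. $M_g$ maps $X$ into $Y$ if $M_g(X)\subset Y$. *)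

theory Defs
  imports "HOL-Complex_Analysis.Complex_Analysis"
begin

abbreviation unit_disc :: "complex set" where
  "unit_disc \<equiv> ball 0 1"

definition disc_area :: "complex measure" where
  "disc_area = uniform_measure lborel unit_disc"

text \<open>
  A function on the disc is represented by a total function on \<^typ>\<open>complex\<close> whose values
  off the disc are irrelevant. All conditions below depend only on the values on the disc.
\<close>

definition Besov :: "real \<Rightarrow> (complex \<Rightarrow> complex) set" where
  "Besov p = {f. f holomorphic_on unit_disc \<and>
     (if p = 1
      then (\<integral>\<^sup>+ z\<in>unit_disc. ennreal (norm (deriv (deriv f) z)) \<partial>disc_area) < \<infinity>
      else (\<integral>\<^sup>+ z\<in>unit_disc.
              ennreal ((1 - norm z) powr (p - 2) * norm (deriv f z) powr p) \<partial>disc_area) < \<infinity>)}"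

text \<open>
  At the logarithmic pole \<open>z = a\<close> the term below evaluates to \<open>0\<close> instead of \<open>\<infinity>\<close>;
  a single point is a null set, so the integrals in \<open>Q_space\<close> are not affected.
\<close>

definition Green :: "complex \<Rightarrow> complex \<Rightarrow> real" where
  "Green z a = ln (norm (1 - cnj a * z) / norm (a - z))"

definition Q_space :: "real \<Rightarrow> (complex \<Rightarrow> complex) set" where
  "Q_space s = {f. f holomorphic_on unit_disc \<and>
     (SUP a\<in>unit_disc. \<integral>\<^sup>+ z\<in>unit_disc.
        ennreal ((norm (deriv f z))\<^sup>2 * Green z a powr s) \<partial>disc_area) < \<infinity>}"

definition mult_op :: "(complex \<Rightarrow> complex) \<Rightarrow> (complex \<Rightarrow> complex) \<Rightarrow> complex \<Rightarrow> complex" where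
  "mult_op g f = (\<lambda>z. g z * f z)"

end

theory Submission
  imports Defs
begin

text \<open>
  If \<open>M\<^sub>g\<close> maps \<open>Q\<^sub>s\<close> into \<open>B\<^sup>p\<close>, then \<open>(1 - \<bar>z\<bar>) \<bar>(g f)'(z)\<bar>\<close> tends to \<open>0\<close> at the boundary
  for every \<open>f\<close> in \<open>Q\<^sub>s\<close>: the area mean value property bounds this quantity by the tail of the
  Besov integral (for \<open>p = 1\<close> it bounds the second derivative, which is then integrated along radii).
  Taking \<open>f = 1\<close> gives the same decay for \<open>g\<close> itself.

  If \<open>g\<close> does not vanish identically, the maximum modulus principle yields points \<open>w\<^sub>n\<close> that
  approach the circle as fast as we please with \<open>\<bar>g(w\<^sub>n)\<bar> \<ge> c > 0\<close>. Let \<open>\<phi>\<^sub>n\<close> be the disc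
  involution exchanging \<open>0\<close> and \<open>w\<^sub>n\<close>, and \<open>f = \<Sum>\<^sub>n (w\<^sub>n - \<phi>\<^sub>n)\<close>. By conformal invariance of
  \<open>\<bar>f'\<bar>\<^sup>2 dA\<close> and of the Green function, the \<open>n\<close>-th summand contributes
  \<open>\<integral> Green u (\<phi>\<^sub>n a) powr s dA(u)\<close> to the \<open>Q\<^sub>s\<close> integral at \<open>a\<close>, which is at most a constant
  times a power of \<open>1 - \<bar>\<phi>\<^sub>n a\<bar>\<^sup>2\<close>. For a sparse sequence these contributions are dominated by a
  two-sided geometric series, so \<open>f\<close> lies in \<open>Q\<^sub>s\<close>. At \<open>w\<^sub>n\<close> the \<open>n\<close>-th summand dominates \<open>f'\<close>,
  hence \<open>(1 - \<bar>w\<^sub>n\<bar>) \<bar>(g f)'(w\<^sub>n)\<bar>\<close> stays bounded below, a contradiction.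
\<close>

subsection \<open>Change of variables for holomorphic maps\<close>

lemma ball_borel [measurable]: "ball c r \<in> sets borel"
  by simp

text \<open>The change of variables formula with a Jacobian determinant lives on
  \<open>real^'n\<close>. This linear map and its inverse carry it to the complex plane.\<close>

definition vec2_complex :: "real^2 \<Rightarrow> complex"
  where "vec2_complex v = Complex (v$1) (v$2)"

definition complex_vec2 :: "complex \<Rightarrow> real^2"
  where "complex_vec2 z = vector [Re z, Im z]"

lemma vec2_complex_inverse [simp]: "complex_vec2 (vec2_complex v) = v"
  by (simp add: complex_vec2_def vec2_complex_def vec_eq_iff forall_2)

lemma complex_vec2_inverse [simp]: "vec2_complex (complex_vec2 z) = z"
  by (simp add: complex_vec2_def vec2_complex_def)

lemma linear_vec2_complex: "linear vec2_complex"
  by (auto intro!: linearI simp: vec2_complex_def complex_eq_iff)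

lemma linear_complex_vec2: "linear complex_vec2"
  by (auto intro!: linearI simp: complex_vec2_def vec_eq_iff forall_2)

lemma vec2_complex_measurable [measurable]: "vec2_complex \<in> borel_measurable borel"
  by (intro borel_measurable_continuous_onI linear_continuous_on
      linear_linear[THEN iffD2] linear_vec2_complex)

text \<open>The preimage of a box is a box with the same side lengths, and Lebesgue measure is
  determined by its values on boxes.\<close>

lemma distr_vec2_complex: "distr lborel borel vec2_complex = (lborel :: complex measure)"
proof (rule lborel_eqI[symmetric])
  fix l u :: complex
  assume lu: "\<And>b. b \<in> Basis \<Longrightarrow> l \<bullet> b \<le> u \<bullet> b"
  have "emeasure (distr lborel borel vec2_complex) (box l u)
      = emeasure lborel (vec2_complex -` box l u)"
    by (simp add: emeasure_distr)
  also have "vec2_complex -` box l u = box (complex_vec2 l) (complex_vec2 u)"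
    by (auto simp: vec2_complex_def complex_vec2_def in_box_complex_iff mem_box_cart forall_2)
  also have "emeasure lborel \<dots> = (\<Prod>b\<in>Basis. (complex_vec2 u - complex_vec2 l) \<bullet> b)"
    using lu[of 1] lu[of \<i>]
    by (intro emeasure_lborel_box)
      (auto simp: Basis_vec_def complex_vec2_def inner_axis Basis_complex_def UNIV_2)
  also have "(\<Prod>b\<in>Basis. (complex_vec2 u - complex_vec2 l) \<bullet> b) = (\<Prod>b\<in>Basis. (u - l) \<bullet> b)"
    by (simp add: Basis_vec_def complex_vec2_def Basis_complex_def UNIV_2 axis_eq_axis
        inner_axis inner_diff_left)
  finally show "emeasure (distr lborel borel vec2_complex) (box l u) = (\<Prod>b\<in>Basis. (u - l) \<bullet> b)" .
qed simp

lemma borel_measurable_norm_deriv_square: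
  assumes "f holomorphic_on D" "open D" "A \<in> sets borel" "A \<subseteq> D"
  shows "(\<lambda>z. ennreal ((norm (deriv f z))\<^sup>2) * indicator A z) \<in> borel_measurable borel"
proof -
  have "continuous_on A (deriv f)"
    using assms holomorphic_deriv holomorphic_on_imp_continuous_on continuous_on_subset by blast
  then have [measurable]: "(\<lambda>z. indicator A z *\<^sub>R deriv f z) \<in> borel_measurable borel"
    using assms(3) by (intro borel_measurable_continuous_on_indicator) auto
  have "(\<lambda>z. ennreal ((norm (indicator A z *\<^sub>R deriv f z))\<^sup>2)) \<in> borel_measurable borel"
    by measurable
  also have "(\<lambda>z. ennreal ((norm (indicator A z *\<^sub>R deriv f z))\<^sup>2))
      = (\<lambda>z. ennreal ((norm (deriv f z))\<^sup>2) * indicator A z)"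
    by (auto simp: fun_eq_iff indicator_def)
  finally show ?thesis .
qed

text \<open>The real derivative of f is multiplication by the complex number f', a matrix whose
  determinant is the squared modulus of f'.\<close>

lemma emeasure_holomorphic_image:
  fixes f :: "complex \<Rightarrow> complex"
  assumes f: "f holomorphic_on D" "open D" "A \<subseteq> D" "inj_on f A"
    and A: "A \<in> sets borel" "f ` A \<in> sets borel" "bounded (f ` A)"
  shows "emeasure lborel (f ` A) = (\<integral>\<^sup>+z\<in>A. ennreal ((norm (deriv f z))\<^sup>2) \<partial>lborel)"
proof -
  define S where "S = vec2_complex -` A"
  define F where "F = complex_vec2 \<circ> f \<circ> vec2_complex"
  define F' where "F' x v = complex_vec2 (deriv f (vec2_complex x) * vec2_complex v)" for x v
  have S: "S \<in> sets borel"
    using measurable_sets[OF vec2_complex_measurable A(1)] by (simp add: S_def)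
  have der: "(F has_derivative F' x) (at x within S)" if "x \<in> S" for x
  proof -
    have "(f has_field_derivative deriv f (vec2_complex x)) (at (vec2_complex x))"
      using f that by (intro holomorphic_derivI[of f D]) (auto simp: S_def)
    then have d: "(f has_derivative (*) (deriv f (vec2_complex x))) (at (vec2_complex x))"
      by (simp add: has_field_derivative_def)
    have a: "(vec2_complex has_derivative vec2_complex) (at x within S)"
      by (rule linear_imp_has_derivative[OF linear_vec2_complex])
    have b: "(complex_vec2 has_derivative complex_vec2) (at y)" for y
      by (rule linear_imp_has_derivative[OF linear_complex_vec2])
    show ?thesis
      unfolding F_def F'_def o_def
      by (rule has_derivative_compose[OF has_derivative_compose[OF a d] b])
  qed
  have inj: "inj_on F S"
    using f(4) by (auto simp: inj_on_def F_def S_def)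
      (metis complex_vec2_inverse vec2_complex_inverse)
  have det: "\<bar>det (matrix (F' x))\<bar> = (norm (deriv f (vec2_complex x)))\<^sup>2" for x
    unfolding cmod_power2
    by (simp add: det_2 matrix_def F'_def complex_vec2_def vec2_complex_def axis_def
        power2_eq_square)
  have img: "F ` S = vec2_complex -` (f ` A)"
    unfolding F_def S_def
    by (auto simp: image_iff) (metis complex_vec2_inverse vec2_complex_inverse vimageI)
  have imgb: "F ` S \<in> sets borel"
    using measurable_sets[OF vec2_complex_measurable A(2)] by (simp add: img)
  have em: "emeasure lborel (F ` S) = emeasure lborel (f ` A)"
    by (subst distr_vec2_complex[symmetric]) (simp add: emeasure_distr A(2) img)
  \<comment> \<open>Boundedness of the image enters here: the change of variables theorem equates
    the integral of the Jacobian with a finite measure.\<close>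
  have fin: "emeasure lborel (f ` A) < \<infinity>"
    using A(3) by (rule emeasure_bounded_finite)
  have lm: "F ` S \<in> lmeasurable"
    using imgb em fin by (intro fmeasurableI) (auto simp: emeasure_completion)
  have "((\<lambda>x. \<bar>det (matrix (F' x))\<bar>) has_integral measure lebesgue (F ` S)) S"
    using has_measure_differentiable_image[OF sets_completionI_sets der inj] S lm by auto
  then have "integral\<^sup>N lborel (\<lambda>x. indicator S x * \<bar>det (matrix (F' x))\<bar>) = measure lebesgue (F ` S)"
    by (intro nn_integral_has_integral_lebesgue) auto
  also have "\<dots> = emeasure lborel (f ` A)"
    using imgb em emeasure_eq_measure2[OF lm] by (simp add: emeasure_completion)
  finally have *: "emeasure lborel (f ` A)
      = integral\<^sup>N lborel (\<lambda>x. ennreal (indicator S x * (norm (deriv f (vec2_complex x)))\<^sup>2))"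
    by (simp add: det)
  have m: "(\<lambda>z. ennreal ((norm (deriv f z))\<^sup>2) * indicator A z) \<in> borel_measurable borel"
    by (rule borel_measurable_norm_deriv_square[OF f(1,2) A(1) f(3)])
  have "(\<integral>\<^sup>+z\<in>A. ennreal ((norm (deriv f z))\<^sup>2) \<partial>distr lborel borel vec2_complex)
      = integral\<^sup>N lborel (\<lambda>x. ennreal (indicator S x * (norm (deriv f (vec2_complex x)))\<^sup>2))"
    using m by (subst nn_integral_distr) (auto intro!: nn_integral_cong simp: S_def indicator_def)
  then show ?thesis by (simp add: * distr_vec2_complex)
qed

lemma nn_integral_holomorphic_image:
  fixes f :: "complex \<Rightarrow> complex" and H :: "complex \<Rightarrow> ennreal"
  assumes f: "f holomorphic_on D" "open D" "inj_on f D" "bounded (f ` D)"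
    and H [measurable]: "H \<in> borel_measurable borel"
  shows "(\<integral>\<^sup>+u\<in>f ` D. H u \<partial>lborel) = (\<integral>\<^sup>+z\<in>D. ennreal ((norm (deriv f z))\<^sup>2) * H (f z) \<partial>lborel)"
proof -
  have D [measurable]: "D \<in> sets borel" using f(2) by simp
  have opn: "open (f ` D)" using open_mapping_thm3[OF f(1,2,3)] .
  have fD [measurable]: "f ` D \<in> sets borel" using opn by simp
  \<comment> \<open>Measurability concerns total functions, so f is extended by 0. The density of
    \<open>M\<close> vanishes off D, hence the extension does not affect the integrals.\<close>
  define F where "F z = (if z \<in> D then f z else 0)" for z
  have F [measurable]: "F \<in> borel_measurable borel"
    unfolding F_def using f holomorphic_on_imp_continuous_on
    by (intro borel_measurable_continuous_on_if) auto
  have [measurable]: "(\<lambda>z. ennreal ((norm (deriv f z))\<^sup>2) * indicator D z) \<in> borel_measurable borel"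
    by (rule borel_measurable_norm_deriv_square[OF f(1,2) D order_refl])
  define M where "M = density lborel (\<lambda>z. ennreal ((norm (deriv f z))\<^sup>2) * indicator D z)"
  have FM [measurable]: "F \<in> measurable M borel" by (simp add: M_def)
  have eq: "distr M borel F = density lborel (indicator (f ` D))"
  proof (rule measure_eqI)
    fix B assume "B \<in> sets (distr M borel F)"
    then have B [measurable]: "B \<in> sets borel" by simp
    have im: "f ` (D \<inter> F -` B) = f ` D \<inter> B" by (auto simp: F_def)
    have mm: "D \<inter> F -` B \<in> sets borel"
      using measurable_sets[OF F B] by simp
    have "emeasure (distr M borel F) B = emeasure M (F -` B)"
      by (simp add: emeasure_distr M_def)
    also have "\<dots> = (\<integral>\<^sup>+z. ennreal ((norm (deriv f z))\<^sup>2) * indicator D z * indicator (F -` B) z \<partial>lborel)"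
      unfolding M_def using measurable_sets[OF F B] by (subst emeasure_density) auto
    also have "\<dots> = (\<integral>\<^sup>+z\<in>(D \<inter> F -` B). ennreal ((norm (deriv f z))\<^sup>2) \<partial>lborel)"
      by (intro nn_integral_cong) (auto simp: indicator_def)
    also have "\<dots> = emeasure lborel (f ` D \<inter> B)"
      using f mm fD B im
      by (subst im[symmetric], subst emeasure_holomorphic_image[of f D])
        (auto intro: inj_on_subset bounded_subset)
    also have "\<dots> = emeasure (density lborel (indicator (f ` D))) B"
      by (subst emeasure_density) (auto simp: indicator_inter_arith[symmetric])
    finally show "emeasure (distr M borel F) B = emeasure (density lborel (indicator (f ` D))) B" .
  qed simp
  have "(\<integral>\<^sup>+u\<in>f ` D. H u \<partial>lborel) = (\<integral>\<^sup>+u. H u \<partial>density lborel (indicator (f ` D)))"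
    by (subst nn_integral_density) (auto simp: mult.commute)
  also have "\<dots> = (\<integral>\<^sup>+z. H (F z) \<partial>M)"
    unfolding eq[symmetric] by (subst nn_integral_distr) auto
  also have "\<dots> = (\<integral>\<^sup>+z. ennreal ((norm (deriv f z))\<^sup>2) * indicator D z * H (F z) \<partial>lborel)"
    unfolding M_def by (subst nn_integral_density) auto
  also have "\<dots> = (\<integral>\<^sup>+z\<in>D. ennreal ((norm (deriv f z))\<^sup>2) * H (f z) \<partial>lborel)"
    by (intro nn_integral_cong) (auto simp: F_def indicator_def)
  finally show ?thesis .
qed

subsection \<open>Disc automorphisms and the Green function\<close>

definition disc_involution :: "complex \<Rightarrow> complex \<Rightarrow> complex"
  where "disc_involution w z = (w - z) / (1 - cnj w * z)"

lemma one_minus_cnj_mult_nonzero: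
  assumes "norm w < 1" "norm z < 1"
  shows "1 - cnj w * z \<noteq> 0"
proof
  assume "1 - cnj w * z = 0"
  then have "norm (cnj w * z) = 1" by (metis eq_iff_diff_eq_0 norm_one)
  moreover have "norm w * norm z < 1"
    using assms by (metis mult_left_le norm_ge_zero order_le_less_trans less_imp_le)
  ultimately show False by (simp add: norm_mult)
qed

text \<open>Division by \<open>(norm (1 - cnj w * z))\<^sup>2\<close> turns this into the
  Schwarz-Pick identity of the next lemma, the source of all size estimates for
  automorphisms.\<close>

lemma norm_one_minus_cnj_mult_square:
  "(norm (1 - cnj w * z))\<^sup>2 - (norm (w - z))\<^sup>2 = (1 - (norm w)\<^sup>2) * (1 - (norm z)\<^sup>2)"
  unfolding cmod_power2 by (simp add: power2_eq_square algebra_simps)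

lemma one_minus_disc_involution_square:
  assumes "norm w < 1" "norm z < 1"
  shows "1 - (norm (disc_involution w z))\<^sup>2
    = (1 - (norm w)\<^sup>2) * (1 - (norm z)\<^sup>2) / (norm (1 - cnj w * z))\<^sup>2"
  using one_minus_cnj_mult_nonzero[OF assms] norm_one_minus_cnj_mult_square[of w z]
  by (simp add: disc_involution_def norm_divide power_divide field_simps)

lemma norm_disc_involution_less_one:
  assumes "norm w < 1" "norm z < 1"
  shows "norm (disc_involution w z) < 1"
proof -
  have "(norm w)\<^sup>2 < 1" "(norm z)\<^sup>2 < 1"
    using assms by (auto simp: abs_square_less_1)
  then have "1 - (norm (disc_involution w z))\<^sup>2 > 0"
    using one_minus_cnj_mult_nonzero[OF assms]
    unfolding one_minus_disc_involution_square[OF assms] by simp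
  then show ?thesis by (simp add: abs_square_less_1)
qed

lemma disc_involution_involution:
  assumes "norm w < 1" "norm z < 1"
  shows "disc_involution w (disc_involution w z) = z"
proof -
  have n: "1 - cnj w * z \<noteq> 0" "1 - cnj w * w \<noteq> 0"
    using one_minus_cnj_mult_nonzero assms by auto
  have a: "w - disc_involution w z = z * (1 - cnj w * w) / (1 - cnj w * z)"
    using n by (simp add: disc_involution_def field_simps)
  have b: "1 - cnj w * disc_involution w z = (1 - cnj w * w) / (1 - cnj w * z)"
    using n by (simp add: disc_involution_def field_simps)
  show ?thesis
    unfolding disc_involution_def[of w "disc_involution w z"] a b using n by simp
qed

lemma disc_involution_image:
  assumes "norm w < 1"
  shows "disc_involution w ` unit_disc = unit_disc" "inj_on (disc_involution w) unit_disc"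
proof -
  show "disc_involution w ` unit_disc = unit_disc"
    using norm_disc_involution_less_one[OF assms] disc_involution_involution[OF assms]
    by (auto simp: image_iff) (metis mem_ball_0)
  show "inj_on (disc_involution w) unit_disc"
    using disc_involution_involution[OF assms]
    by (intro inj_on_inverseI[where g = "disc_involution w"]) simp
qed

lemma has_field_derivative_disc_involution:
  assumes "norm w < 1" "norm z < 1"
  shows "(disc_involution w has_field_derivative
    - (1 - (norm w)\<^sup>2) / (1 - cnj w * z)\<^sup>2) (at z)"
proof -
  have "(1 :: complex) - (norm w)\<^sup>2 = 1 - cnj w * w"
    by (simp add: complex_norm_square mult.commute flip: of_real_power)
  then show ?thesis
    unfolding disc_involution_def
    using one_minus_cnj_mult_nonzero[OF assms]
    by (auto intro!: derivative_eq_intros simp: field_simps power2_eq_square)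
qed

lemma holomorphic_disc_involution:
  assumes "norm w < 1"
  shows "disc_involution w holomorphic_on unit_disc"
  unfolding holomorphic_on_open[OF open_ball]
  by (intro ballI exI, rule has_field_derivative_disc_involution[OF assms]) simp

text \<open>Numerator and denominator inside the logarithm are multiplied by the same positive
  factor \<open>k\<close>, which cancels.\<close>

lemma Green_disc_involution:
  assumes "norm w < 1" "norm z < 1" "norm a < 1"
  shows "Green (disc_involution w z) (disc_involution w a) = Green z a"
proof -
  have n: "1 - cnj w * z \<noteq> 0" "1 - cnj w * w \<noteq> 0" "1 - cnj w * a \<noteq> 0" "1 - w * cnj a \<noteq> 0"
    using one_minus_cnj_mult_nonzero assms by (auto simp: mult.commute[of w "cnj a"])
  define k where "k = norm (1 - cnj w * w) / (norm (1 - cnj w * a) * norm (1 - cnj w * z))"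
  have k: "k \<noteq> 0" using n by (simp add: k_def)
  have "disc_involution w a - disc_involution w z
      = (1 - cnj w * w) * (z - a) / ((1 - cnj w * a) * (1 - cnj w * z))"
    using n by (simp add: disc_involution_def divide_simps) algebra
  then have 1: "norm (disc_involution w a - disc_involution w z) = k * norm (a - z)"
    by (simp add: k_def norm_divide norm_mult norm_minus_commute)
  have "1 - cnj (disc_involution w a) * disc_involution w z
      = (1 - cnj w * w) * (1 - cnj a * z) / ((1 - w * cnj a) * (1 - cnj w * z))"
    using n by (simp add: disc_involution_def divide_simps) algebra
  moreover have "norm (1 - w * cnj a) = norm (1 - cnj w * a)"
    by (metis complex_cnj_cnj complex_cnj_diff complex_cnj_mult complex_cnj_one complex_mod_cnj)
  ultimately have 2: "norm (1 - cnj (disc_involution w a) * disc_involution w z) = k * norm (1 - cnj a * z)"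
    by (simp add: k_def norm_divide norm_mult)
  show ?thesis
    unfolding Green_def 1 2 using k by simp
qed

section \<open>Powers of the Green function: pointwise and integral bounds\<close>

text \<open>
  The inequality \<open>ln y \<le> y - 1\<close> at \<open>y = x powr (- d)\<close>. The exponent \<open>d\<close> is chosen so that the
  singularity at \<open>x = 0\<close> is at most \<open>1 / x\<close>, which is integrable in the plane; capping the power of
  \<open>1 - x\<^sup>2\<close> at \<open>1/2\<close> makes the denominator \<open>\<bar>1 - cnj b u\<bar>\<close> disappear in the next lemma.
\<close>
lemma neg_ln_powr_le:
  fixes x s :: real
  assumes "0 < s" "0 < x" "x < 1"
  shows "(- ln x) powr s \<le> (1 / min 1 (1 / s)) powr s * ((1 - x\<^sup>2) powr min s (1/2) / x)"
proof -
  define d where "d = min 1 (1 / s)"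
  have d: "0 < d" "d \<le> 1" "d * s \<le> 1"
    using assms by (auto simp: d_def min_def field_simps)
  have x2: "0 < 1 - x\<^sup>2" "1 - x\<^sup>2 \<le> 1" using assms by (auto simp: abs_square_less_1)
  have "ln (x powr (-d)) \<le> x powr (-d) - 1" using assms by (intro ln_le_minus_one) auto
  then have "- ln x \<le> (1 / d) * (x powr (-d) - 1)"
    using assms d by (simp add: ln_powr field_simps)
  also have "x powr (-d) - 1 = x powr (-d) * (1 - x powr d)"
    using assms by (simp add: algebra_simps powr_add[symmetric])
  also have "x powr d \<ge> x powr 2"
    using assms d by (intro powr_mono') auto
  then have "(1 / d) * (x powr (-d) * (1 - x powr d)) \<le> (1 / d) * (x powr (-d) * (1 - x\<^sup>2))"
    using d assms by (intro mult_left_mono) auto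
  finally have "(- ln x) powr s \<le> ((1 / d) * (x powr (-d) * (1 - x\<^sup>2))) powr s"
    using assms by (intro powr_mono2) auto
  also have "\<dots> = (1 / d) powr s * ((1 - x\<^sup>2) powr s * x powr (- (d * s)))"
  proof -
    have "((1 / d) * (x powr (-d) * (1 - x\<^sup>2))) powr s
        = (1 / d) powr s * ((x powr (-d)) powr s * (1 - x\<^sup>2) powr s)"
      using d x2 by (subst powr_mult | simp)+
    then show ?thesis by (simp only: powr_powr mult_ac minus_mult_left)
  qed
  also have "\<dots> \<le> (1 / d) powr s * ((1 - x\<^sup>2) powr min s (1/2) * x powr (-1))"
    using d x2 assms by (intro mult_left_mono mult_mono powr_mono') auto
  also have "x powr (-1) = 1 / x" using assms by (simp add: powr_minus_divide)
  finally show ?thesis by (simp add: d_def)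
qed

text \<open>Off the pole, \<open>Green u b\<close> is \<open>- ln x\<close> with x = |\<phi>_b(u)|.
  In the bound of \<open>neg_ln_powr_le\<close> the quantity 1 - x^2 factors by the Schwarz-Pick
  identity, and 1/x is N / |b - u|. Since e \<le> 1/2, the remaining power of N has exponent 1 - 2e
  \<ge> 0, so N \<le> 2 controls it.\<close>

lemma Green_powr_le:
  assumes "0 < s" "norm b < 1" "norm u < 1"
  shows "Green u b powr s
    \<le> 2 * (1 / min 1 (1 / s)) powr s * (1 - (norm b)\<^sup>2) powr min s (1/2) / norm (b - u)"
proof (cases "b = u")
  case True
  \<comment> \<open>At the pole both sides are 0, since division by zero and \<open>ln 0\<close>
    evaluate to 0.\<close>
  then show ?thesis by (simp add: Green_def)
next
  case False
  define x where "x = norm (disc_involution b u)"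
  define e where "e = min s (1/2)"
  have e: "0 < e" "e \<le> 1/2" using assms by (auto simp: e_def)
  define N where "N = norm (1 - cnj b * u)"
  have N: "0 < N" using one_minus_cnj_mult_nonzero assms by (auto simp: N_def)
  have "norm (cnj b * u) \<le> 1"
    using assms by (simp add: norm_mult mult_le_one)
  then have N2: "N \<le> 2"
    unfolding N_def using norm_triangle_ineq4[of 1 "cnj b * u"] by simp
  have x_eq: "x = norm (b - u) / N" by (simp add: x_def disc_involution_def norm_divide N_def)
  have x: "0 < x" "x < 1"
    using False N norm_disc_involution_less_one[OF assms(2,3)]
    unfolding x_def[symmetric] by (simp_all add: x_eq)
  have sq: "0 < 1 - (norm b)\<^sup>2" "0 < 1 - (norm u)\<^sup>2" "1 - (norm u)\<^sup>2 \<le> 1"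
    using assms by (auto simp: abs_square_less_1)
  have "Green u b = - ln x"
    using False N by (simp add: Green_def x_eq N_def[symmetric] ln_div)
  then have "Green u b powr s \<le> (1 / min 1 (1 / s)) powr s * ((1 - x\<^sup>2) powr e / x)"
    using neg_ln_powr_le[OF assms(1) x] by (simp add: e_def)
  also have "(1 - x\<^sup>2) powr e / x \<le> (1 - (norm b)\<^sup>2) powr e * 2 / norm (b - u)"
  proof -
    have "(1 - x\<^sup>2) powr e / x = (1 - (norm b)\<^sup>2) powr e * (1 - (norm u)\<^sup>2) powr e
        * (N powr 1 / (N\<^sup>2) powr e) / norm (b - u)"
      unfolding x_def one_minus_disc_involution_square[OF assms(2,3)]
      using sq N by (simp add: powr_mult powr_divide N_def[symmetric] x_def[symmetric] x_eq)
    also have "N powr 1 / (N\<^sup>2) powr e = N powr (1 - 2 * e)"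
      using N by (simp add: powr_diff powr_powr flip: powr_numeral)
    also have "(1 - (norm b)\<^sup>2) powr e * (1 - (norm u)\<^sup>2) powr e * N powr (1 - 2 * e) / norm (b - u)
       \<le> (1 - (norm b)\<^sup>2) powr e * 1 * 2 / norm (b - u)"
    proof (intro divide_right_mono mult_mono)
      show "(1 - (norm u)\<^sup>2) powr e \<le> 1" using sq e by (intro powr_le1) auto
      have "N powr (1 - 2 * e) \<le> 2 powr (1 - 2 * e)" using N N2 e by (intro powr_mono2) auto
      also have "\<dots> \<le> 2 powr 1" using e by (intro powr_mono) auto
      finally show "N powr (1 - 2 * e) \<le> 2" by simp
    qed auto
    finally show ?thesis by simp
  qed
  then have "(1 / min 1 (1 / s)) powr s * ((1 - x\<^sup>2) powr e / x)
     \<le> (1 / min 1 (1 / s)) powr s * ((1 - (norm b)\<^sup>2) powr e * 2 / norm (b - u))"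
    by (intro mult_left_mono) auto
  finally show ?thesis by (simp add: e_def mult_ac)
qed

text \<open>A dyadic decomposition takes the place of polar coordinates. The weight 2^n on the disc
  of radius 2 * 2^(-n) about b integrates to 4 pi 2^(-n), and these values sum to 8 pi.\<close>

lemma nn_integral_inverse_distance_le:
  assumes "norm b < 1"
  shows "(\<integral>\<^sup>+u\<in>unit_disc. ennreal (1 / norm (b - u)) \<partial>lborel) \<le> ennreal (8 * pi)"
proof -
  have "(\<integral>\<^sup>+u\<in>unit_disc. ennreal (1 / norm (b - u)) \<partial>lborel)
      \<le> (\<integral>\<^sup>+u. (\<Sum>n. ennreal (2 ^ n) * indicator (ball b (2 * (1/2) ^ n)) u) \<partial>lborel)"
  proof (rule nn_integral_mono)
    fix u
    show "ennreal (1 / norm (b - u)) * indicator unit_disc u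
        \<le> (\<Sum>n. ennreal (2 ^ n) * indicator (ball b (2 * (1/2) ^ n)) u)" (is "_ \<le> suminf ?h")
    proof (cases "norm u < 1 \<and> b \<noteq> u")
      case True
      define d where "d = norm (b - u)"
      have d: "0 < d" "d < 2"
        using True assms norm_triangle_ineq4[of b u] by (auto simp: d_def)
      then obtain n where "(1/2) ^ n < d" using real_arch_pow_inv[of d "1/2"] by auto
      then have ex: "\<exists>n. (1/2) ^ n \<le> d" by (meson less_imp_le)
      \<comment> \<open>By minimality of n, the distance d lies between 2^(-n) and twice that
        number, so the n-th summand alone dominates 1/d. For n = 0 the upper bound is d < 2.\<close>
      define n where "n = (LEAST n. (1/2) ^ n \<le> d)"
      have n: "(1/2) ^ n \<le> d" unfolding n_def using ex by (rule LeastI_ex)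
      have "d < 2 * (1/2) ^ n"
      proof (cases n)
        case 0 then show ?thesis using d by simp
      next
        case (Suc m)
        then have "\<not> (1/2) ^ m \<le> d" using not_less_Least[of m "\<lambda>n. (1/2) ^ n \<le> d"] by (simp add: n_def)
        then show ?thesis by (simp add: Suc)
      qed
      then have "?h n = ennreal (2 ^ n)" by (simp add: d_def dist_norm)
      moreover have "1 / d \<le> 2 ^ n" using n d by (simp add: field_simps power_divide)
      ultimately have "ennreal (1 / d) \<le> ?h n" by simp
      also have "\<dots> \<le> suminf ?h" using sum_le_suminf[OF summableI, of "{n}" ?h]
        by (simp del: sum_mult_indicator)
      finally show ?thesis using True by (simp add: d_def)
    qed (auto simp: indicator_def)
  qed
  also have "\<dots> = (\<Sum>n. \<integral>\<^sup>+u. ennreal (2 ^ n) * indicator (ball b (2 * (1/2) ^ n)) u \<partial>lborel)"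
    by (rule nn_integral_suminf) auto
  also have "\<dots> = (\<Sum>n. ennreal (4 * pi * (1/2) ^ n))"
  proof (rule suminf_cong)
    fix n :: nat
    have "(2::real) ^ n * (pi * (2 * (1/2) ^ n)\<^sup>2) = 4 * pi * (1/2) ^ n"
      by (simp add: power_mult_distrib power_divide power2_eq_square field_simps)
    then show "(\<integral>\<^sup>+u. ennreal (2 ^ n) * indicator (ball b (2 * (1/2) ^ n)) u \<partial>lborel)
        = ennreal (4 * pi * (1/2) ^ n)"
      by (subst nn_integral_cmult_indicator)
        (simp_all add: emeasure_ball unit_ball_vol_2 ennreal_mult[symmetric])
  qed
  also have "\<dots> = ennreal (\<Sum>n. 4 * pi * (1/2) ^ n)"
    by (rule suminf_ennreal2) (auto intro!: summable_mult summable_geometric)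
  also have "(\<Sum>n. 4 * pi * (1/2) ^ n) = 8 * pi"
    by (subst suminf_mult) (auto simp: suminf_geometric intro: summable_geometric)
  finally show ?thesis .
qed

lemma Green_measurable [measurable]: "(\<lambda>z. Green z a) \<in> borel_measurable borel"
  unfolding Green_def by measurable

text \<open>Integration removes the singularity 1 / |b - u| uniformly in b. The surviving power of 1
  - |b|^2 supplies the geometric decay in \<open>bump_series_in_Q_space\<close>.\<close>

lemma nn_integral_Green_powr_le:
  assumes "0 < s"
  shows "\<exists>C>0. \<forall>b. norm b < 1 \<longrightarrow> (\<integral>\<^sup>+u\<in>unit_disc. ennreal (Green u b powr s) \<partial>lborel)
       \<le> ennreal (C * (1 - (norm b)\<^sup>2) powr min s (1/2))"
proof (intro exI conjI allI impI)
  define K where "K = 2 * (1 / min 1 (1 / s)) powr s"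
  have K: "0 < K" using assms by (simp add: K_def min_def)
  then show "0 < K * (8 * pi)" by simp
  fix b :: complex assume b: "norm b < 1"
  define M where "M = K * (1 - (norm b)\<^sup>2) powr min s (1/2)"
  have M: "0 \<le> M" using K by (simp add: M_def)
  have "(\<integral>\<^sup>+u\<in>unit_disc. ennreal (Green u b powr s) \<partial>lborel)
      \<le> (\<integral>\<^sup>+u. ennreal M * (ennreal (1 / norm (b - u)) * indicator unit_disc u) \<partial>lborel)"
    using Green_powr_le[OF assms b] M
    by (intro nn_integral_mono)
      (auto simp: indicator_def M_def K_def ennreal_mult[symmetric] intro!: ennreal_leI)
  also have "\<dots> = ennreal M * (\<integral>\<^sup>+u\<in>unit_disc. ennreal (1 / norm (b - u)) \<partial>lborel)"
    by (rule nn_integral_cmult) measurable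
  also have "\<dots> \<le> ennreal M * ennreal (8 * pi)"
    by (intro mult_left_mono nn_integral_inverse_distance_le b) auto
  also have "\<dots> = ennreal (K * (8 * pi) * (1 - (norm b)\<^sup>2) powr min s (1/2))"
    using M by (simp add: ennreal_mult[symmetric] M_def mult_ac)
  finally show "(\<integral>\<^sup>+u\<in>unit_disc. ennreal (Green u b powr s) \<partial>lborel)
     \<le> ennreal (K * (8 * pi) * (1 - (norm b)\<^sup>2) powr min s (1/2))" .
qed

text \<open>Substitute u = \<phi>_w(z). The squared derivative is the Jacobian, and invariance of
  the Green function moves the pole from a to \<phi>_w(a).\<close>

lemma nn_integral_disc_involution_Green:
  assumes "norm w < 1" "norm a < 1"
  shows "(\<integral>\<^sup>+z\<in>unit_disc. ennreal ((norm (deriv (disc_involution w) z))\<^sup>2 * Green z a powr s) \<partial>lborel)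
    = (\<integral>\<^sup>+u\<in>unit_disc. ennreal (Green u (disc_involution w a) powr s) \<partial>lborel)"
proof -
  let ?H = "\<lambda>u. ennreal (Green u (disc_involution w a) powr s)"
  have "(\<integral>\<^sup>+u\<in>disc_involution w ` unit_disc. ?H u \<partial>lborel)
    = (\<integral>\<^sup>+z\<in>unit_disc. ennreal ((norm (deriv (disc_involution w) z))\<^sup>2) * ?H (disc_involution w z) \<partial>lborel)"
    using assms
    by (intro nn_integral_holomorphic_image holomorphic_disc_involution disc_involution_image)
      (auto simp: disc_involution_image)
  also have "\<dots> = (\<integral>\<^sup>+z\<in>unit_disc. ennreal ((norm (deriv (disc_involution w) z))\<^sup>2 * Green z a powr s) \<partial>lborel)"
    using assms
    by (intro nn_integral_cong) (auto simp: indicator_def Green_disc_involution ennreal_mult)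
  finally show ?thesis by (simp add: disc_involution_image assms)
qed

subsection \<open>Boundary decay of Besov functions\<close>

text \<open>Convexity: the graph of the p-th power lies above its tangent at M. Young's inequality
  with weights 1/p and 1 - 1/p gives this. Integrating the tangent line later plays the part of
  Jensen's inequality.\<close>

lemma powr_tangent_le:
  fixes x M p :: real
  assumes "0 \<le> x" "0 < M" "1 \<le> p"
  shows "M powr p + p * M powr (p - 1) * (x - M) \<le> x powr p"
proof -
  have M: "M powr (p - 1) * M = M powr p"
    using assms by (simp add: powr_diff)
  have "p * M powr (p - 1) * x \<le> x powr p + (p - 1) * M powr p"
  proof (cases "x = 0")
    case False
    have "(x powr p) powr (1 / p) * (M powr p) powr (1 - 1 / p)
        \<le> (1 / p) * x powr p + (1 - 1 / p) * M powr p"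
      using assms False by (intro Youngs_inequality_0) auto
    moreover have "(x powr p) powr (1 / p) = x" "(M powr p) powr (1 - 1 / p) = M powr (p - 1)"
      using assms False by (auto simp: powr_powr right_diff_distrib)
    ultimately have "p * (x * M powr (p - 1)) \<le> p * ((1 / p) * x powr p + (1 - 1 / p) * M powr p)"
      using assms by (intro mult_left_mono) auto
    also have "\<dots> = x powr p + (p - 1) * M powr p" using assms by (simp add: field_simps)
    finally show ?thesis by (simp add: mult_ac)
  qed (use assms in auto)
  then show ?thesis using M by (simp add: algebra_simps)
qed

text \<open>By Cauchy's formula Q(0) is the mean of Q over the circle, so M = |Q(0)| is at most the
  mean of |Q|. Then the tangent inequality at M is integrated.\<close>

lemma circle_mean_powr_ge:
  assumes Q: "Q holomorphic_on S" "open S" "cball 0 1 \<subseteq> S" and p: "1 \<le> p"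
  shows "ennreal (norm (Q 0) powr p)
    \<le> (\<integral>\<^sup>+\<theta>\<in>{0..1}. ennreal (norm (Q (exp (2 * of_real pi * \<i> * of_real \<theta>))) powr p) \<partial>lborel)"
proof (cases "Q 0 = 0")
  case False
  define M where "M = norm (Q 0)"
  have M: "0 < M" using False by (simp add: M_def)
  define e where "e \<theta> = exp (2 * of_real pi * \<i> * of_real \<theta>)" for \<theta> :: real
  have e1: "norm (e \<theta>) = 1" for \<theta> by (simp add: e_def)
  have e0: "e \<theta> \<noteq> 0" for \<theta> by (simp add: e_def)
  have cp: "circlepath 0 1 \<theta> = e \<theta>" for \<theta> by (simp add: circlepath e_def)
  have ce: "continuous_on A e" for A unfolding e_def by (intro continuous_intros)
  have cQ: "continuous_on {0..1} (\<lambda>\<theta>. Q (e \<theta>))"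
    using Q e1
    by (intro continuous_on_compose2[OF holomorphic_on_imp_continuous_on[OF Q(1)] ce]) auto
  have "((\<lambda>u. Q u / (u - 0)) has_contour_integral (2 * of_real pi * \<i> * Q 0)) (circlepath 0 1)"
    using Q by (intro Cauchy_integral_circlepath_simple) (auto intro: holomorphic_on_subset)
  then have "((\<lambda>\<theta>. Q (e \<theta>) / e \<theta> * (2 * of_real pi * \<i> * e \<theta>))
      has_integral (2 * of_real pi * \<i> * Q 0)) {0..1}"
    unfolding has_contour_integral_def
    by (rule has_integral_eq[rotated]) (simp add: vector_derivative_circlepath01 cp e_def)
  then have "((\<lambda>\<theta>. 1 / (2 * of_real pi * \<i>) * (Q (e \<theta>) / e \<theta> * (2 * of_real pi * \<i> * e \<theta>)))
      has_integral 1 / (2 * of_real pi * \<i>) * (2 * of_real pi * \<i> * Q 0)) {0..1}"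
    by (rule has_integral_mult_right)
  then have hi: "((\<lambda>\<theta>. Q (e \<theta>)) has_integral Q 0) {0..1}"
    using e0 by simp
  define c where "c \<theta> = norm (Q (e \<theta>))" for \<theta>
  have cc: "continuous_on {0..1} c" unfolding c_def by (intro continuous_intros cQ)
  have c0: "0 \<le> c \<theta>" for \<theta> by (simp add: c_def)
  have ci: "c integrable_on {0..1}" by (rule integrable_continuous_interval[OF cc])
  have cpi: "(\<lambda>\<theta>. c \<theta> powr p) integrable_on {0..1}"
    using p by (intro integrable_continuous_interval continuous_on_powr' cc continuous_intros)
      (auto simp: c_def)
  have "norm (integral {0..1} (\<lambda>\<theta>. Q (e \<theta>))) \<le> integral {0..1} c"
    using hi ci by (intro integral_norm_bound_integral) (auto simp: c_def)
  then have Mc: "M \<le> integral {0..1} c" using hi by (simp add: M_def integral_unique)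
  \<comment> \<open>The mean of \<open>c\<close> is at least M, so the linear term is
    non-negative.\<close>
  have "M powr p \<le> M powr p + p * M powr (p - 1) * (integral {0..1} c - M)"
    using Mc p by (simp)
  also have "\<dots> = integral {0..1} (\<lambda>\<theta>. M powr p + p * M powr (p - 1) * (c \<theta> - M))"
  proof -
    have "((\<lambda>\<theta>. M powr p + p * M powr (p - 1) * (c \<theta> - M)) has_integral
       (1 - 0) *\<^sub>R M powr p + p * M powr (p - 1) * (integral {0..1} c - (1 - 0) *\<^sub>R M)) {0..1}"
      using ci has_integral_const_real[of _ 0 1]
      by (intro has_integral_add has_integral_mult_right has_integral_diff integrable_integral) auto
    then show ?thesis by (simp add: integral_unique)
  qed
  also have "\<dots> \<le> integral {0..1} (\<lambda>\<theta>. c \<theta> powr p)"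
    using ci cpi M p
    by (intro integral_le powr_tangent_le integrable_add integrable_on_mult_right integrable_diff
         integrable_const_ivl) (auto simp: c0)
  finally have "ennreal (M powr p) \<le> ennreal (integral {0..1} (\<lambda>\<theta>. c \<theta> powr p))"
    by (rule ennreal_leI)
  also have "\<dots> = (\<integral>\<^sup>+\<theta>\<in>{0..1}. ennreal (c \<theta> powr p) \<partial>lborel)"
    using cpi by (intro nn_integral_has_integral_lebesgue'[symmetric]) (auto intro: integrable_integral)
  finally show ?thesis by (simp add: M_def c_def e_def)
qed simp

text \<open>
  Polar coordinates are avoided: the area integral is invariant under rotations about \<open>z\<close>, and the
  average over all rotations is estimated by the circle mean value inequality.
\<close>
lemma area_mean_powr_ge:
  assumes H: "H holomorphic_on ball z r" and p: "1 \<le> p"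
  shows "ennreal (norm (H z) powr p) * emeasure lborel (ball z r)
    \<le> (\<integral>\<^sup>+u\<in>ball z r. ennreal (norm (H u) powr p) \<partial>lborel)"
proof -
  define B where "B = ball z r"
  have B [measurable]: "B \<in> sets borel" by (simp add: B_def)
  define H0 where "H0 u = (if u \<in> B then H u else 0)" for u
  have H0 [measurable]: "H0 \<in> borel_measurable borel"
    unfolding H0_def using H holomorphic_on_imp_continuous_on
    by (intro borel_measurable_continuous_on_if) (auto simp: B_def)
  define K where "K u = ennreal (norm (H0 u) powr p)" for u
  have K [measurable]: "K \<in> borel_measurable borel" unfolding K_def by measurable
  define e where "e \<theta> = exp (2 * of_real pi * \<i> * of_real \<theta>)" for \<theta> :: real
  have e1: "norm (e \<theta>) = 1" for \<theta> by (simp add: e_def)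
  have e0: "e \<theta> \<noteq> 0" for \<theta> by (simp add: e_def)
  define R where "R \<theta> u = z + e \<theta> * (u - z)" for \<theta> u
  have Rc: "continuous_on UNIV (\<lambda>x. R (fst x) (snd x))"
    unfolding R_def e_def by (intro continuous_intros)
  have Rm [measurable]: "(\<lambda>x. R (fst x) (snd x)) \<in> borel_measurable (borel \<Otimes>\<^sub>M borel)"
    using borel_measurable_continuous_onI[OF Rc] by (simp add: borel_prod)
  have dR: "dist z (R \<theta> u) = dist z u" for \<theta> u
    by (simp add: R_def dist_norm norm_mult e1 norm_minus_commute)
  have inv: "(\<integral>\<^sup>+u\<in>B. K (R \<theta> u) \<partial>lborel) = (\<integral>\<^sup>+u\<in>B. K u \<partial>lborel)" for \<theta>
  proof -
    have "R \<theta> ` B = B"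
    proof
      show "R \<theta> ` B \<subseteq> B" using dR by (auto simp: B_def)
      show "B \<subseteq> R \<theta> ` B"
      proof
        fix u assume u: "u \<in> B"
        define v where "v = z + (u - z) / e \<theta>"
        have "R \<theta> v = u" using e0 by (simp add: R_def v_def)
        moreover have "v \<in> B" using dR[of \<theta> v] u calculation by (simp add: B_def)
        ultimately show "u \<in> R \<theta> ` B" by blast
      qed
    qed
    moreover have "R \<theta> holomorphic_on B" unfolding R_def by (intro holomorphic_intros)
    moreover have "inj_on (R \<theta>) B" using e0 by (auto simp: inj_on_def R_def)
    moreover have "deriv (R \<theta>) u = e \<theta>" for u
      unfolding R_def by (intro DERIV_imp_deriv) (auto intro!: derivative_eq_intros)
    ultimately show ?thesis
      using nn_integral_holomorphic_image[of "R \<theta>" B K] by (simp add: B_def e1)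
  qed
  have "K z * emeasure lborel B = (\<integral>\<^sup>+u. K z * indicator B u \<partial>lborel)"
    by (simp add: nn_integral_cmult_indicator)
  also have "\<dots> \<le> (\<integral>\<^sup>+u. (\<integral>\<^sup>+\<theta>. K (R \<theta> u) * indicator B u * indicator {0..1} \<theta> \<partial>lborel) \<partial>lborel)"
  proof (rule nn_integral_mono)
    fix u
    show "K z * indicator B u \<le> (\<integral>\<^sup>+\<theta>. K (R \<theta> u) * indicator B u * indicator {0..1} \<theta> \<partial>lborel)"
    proof (cases "u \<in> B")
      case True
      \<comment> \<open>The circle inequality is applied to w \<mapsto> H(z + w (u - z)), whose
        value at 0 is H(z). Its domain contains the closed unit disc because |w| \<le> 1 does not
        increase the distance from z.\<close>
      define S where "S = (\<lambda>w. z + w * (u - z)) -` B"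
      have S: "open S"
        unfolding S_def B_def
        by (intro open_vimage) (auto intro!: continuous_intros)
      have SB: "cball 0 1 \<subseteq> S"
      proof
        fix w :: complex assume "w \<in> cball 0 1"
        then have "norm w * norm (u - z) \<le> 1 * norm (u - z)" by (intro mult_right_mono) auto
        then show "w \<in> S"
          using True by (simp add: S_def B_def dist_norm norm_mult norm_minus_commute)
      qed
      have "(\<lambda>w. H (z + w * (u - z))) holomorphic_on S"
        by (rule holomorphic_on_compose_gen[OF _ H, unfolded o_def])
          (auto simp: S_def B_def intro!: holomorphic_intros)
      from circle_mean_powr_ge[OF this S SB p]
      have "ennreal (norm (H z) powr p)
        \<le> (\<integral>\<^sup>+\<theta>\<in>{0..1}. ennreal (norm (H (R \<theta> u)) powr p) \<partial>lborel)"
        by (simp add: R_def e_def)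
      moreover have "z \<in> B"
        using True zero_le_dist[of z u] by (auto simp: B_def simp del: zero_le_dist)
      moreover have "R \<theta> u \<in> B" for \<theta> using True dR by (simp add: B_def)
      ultimately show ?thesis using True by (simp add: K_def H0_def)
    qed simp
  qed
  also have "\<dots> = (\<integral>\<^sup>+\<theta>. (\<integral>\<^sup>+u. K (R \<theta> u) * indicator B u * indicator {0..1} \<theta> \<partial>lborel) \<partial>lborel)"
  proof (rule lborel_pair.Fubini')
    have [measurable]: "(\<lambda>x. K (R (fst x) (snd x))) \<in> borel_measurable (borel \<Otimes>\<^sub>M borel)"
      by (rule measurable_compose[OF Rm K])
    show "(\<lambda>(\<theta>, u). K (R \<theta> u) * indicator B u * indicator {0..1} \<theta>)
        \<in> borel_measurable (lborel \<Otimes>\<^sub>M lborel)"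
      unfolding case_prod_beta by measurable
  qed
  also have "\<dots> = (\<integral>\<^sup>+\<theta>. (\<integral>\<^sup>+u\<in>B. K u \<partial>lborel) * indicator {0..1} (\<theta>::real) \<partial>lborel)"
  proof (rule nn_integral_cong)
    fix \<theta> :: real
    have [measurable]: "R \<theta> \<in> borel_measurable borel"
      unfolding R_def by measurable
    show "(\<integral>\<^sup>+u. K (R \<theta> u) * indicator B u * indicator {0..1} \<theta> \<partial>lborel)
        = (\<integral>\<^sup>+u\<in>B. K u \<partial>lborel) * indicator {0..1} \<theta>"
      by (subst inv[of \<theta>, symmetric], subst nn_integral_multc) auto
  qed
  also have "\<dots> = (\<integral>\<^sup>+u\<in>B. K u \<partial>lborel)"
    by (subst nn_integral_cmult_indicator) auto
  also have "\<dots> = (\<integral>\<^sup>+u\<in>ball z r. ennreal (norm (H u) powr p) \<partial>lborel)"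
    by (intro nn_integral_cong) (auto simp: K_def H0_def B_def indicator_def)
  finally have *: "K z * emeasure lborel B \<le> \<dots>" .
  show ?thesis
  proof (cases "0 < r")
    case True
    then show ?thesis using * by (simp add: K_def H0_def B_def)
  qed (simp add: ball_empty)
qed

text \<open>On the disc of radius (1 - |z|)/2 about z the weight is comparable to its value at z, so
  the area mean inequality bounds the left side by a constant times the integral over that disc.
  This disc lies in an annulus near the circle, where a convergent integral has a small
  tail.\<close>

lemma weighted_integral_decay:
  assumes H: "H holomorphic_on unit_disc" and p: "1 \<le> p"
    and fin: "(\<integral>\<^sup>+z\<in>unit_disc. ennreal ((1 - norm z) powr (\<alpha> - 2) * norm (H z) powr p) \<partial>lborel) < \<infinity>"
    and \<epsilon>: "0 < \<epsilon>"
  shows "\<exists>\<rho><1. \<forall>z. \<rho> < norm z \<and> norm z < 1 \<longrightarrow> (1 - norm z) powr \<alpha> * norm (H z) powr p < \<epsilon>"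
proof -
  \<comment> \<open>For u in the small disc, (1 - |u|)/(1 - |z|) lies between 1/2 and 3/2. Which end
    is extremal depends on the sign of \<alpha> - 2, whence the minimum. The factor pi/4 in
    \<open>\<eta>\<close> comes from the area pi t^2 / 4 of that disc.\<close>
  define \<kappa> where "\<kappa> = min ((1/2) powr (\<alpha> - 2)) ((3/2) powr (\<alpha> - 2) :: real)"
  have \<kappa>: "0 < \<kappa>" by (simp add: \<kappa>_def)
  define \<eta> where "\<eta> = \<epsilon> * \<kappa> * pi / 4"
  have \<eta>: "0 < \<eta>" using \<epsilon> \<kappa> by (simp add: \<eta>_def)
  define H0 where "H0 u = (if u \<in> unit_disc then H u else 0)" for u
  have H0 [measurable]: "H0 \<in> borel_measurable borel"
    unfolding H0_def using H holomorphic_on_imp_continuous_on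
    by (intro borel_measurable_continuous_on_if) auto
  define U where "U z = ennreal ((1 - norm z) powr (\<alpha> - 2) * norm (H0 z) powr p) * indicator unit_disc z" for z
  have U [measurable]: "U \<in> borel_measurable borel" unfolding U_def by measurable
  have finU: "(\<integral>\<^sup>+z. U z \<partial>lborel) < \<infinity>"
  proof -
    have "(\<integral>\<^sup>+z. U z \<partial>lborel) = (\<integral>\<^sup>+z\<in>unit_disc. ennreal ((1 - norm z) powr (\<alpha> - 2) * norm (H z) powr p) \<partial>lborel)"
      by (intro nn_integral_cong) (auto simp: U_def H0_def indicator_def)
    then show ?thesis using fin by simp
  qed
  define A where "A n = {z::complex. 1 - inverse (real (Suc n)) \<le> norm z}" for n
  have A [measurable]: "A n \<in> sets borel" for n unfolding A_def by measurable
  \<comment> \<open>The tails tend to 0 by dominated convergence, with \<open>U\<close> itself as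
    the integrable majorant.\<close>
  have "(\<lambda>n. \<integral>\<^sup>+z. U z * indicator (A n) z \<partial>lborel) \<longlonglongrightarrow> (\<integral>\<^sup>+z. 0 \<partial>(lborel :: complex measure))"
  proof (rule nn_integral_dominated_convergence[where w = U])
    show "AE z in lborel. (\<lambda>n. U z * indicator (A n) z) \<longlonglongrightarrow> 0"
    proof (rule AE_I2)
      fix z :: complex
      show "(\<lambda>n. U z * indicator (A n) z) \<longlonglongrightarrow> 0"
      proof (cases "norm z < 1")
        case True
        then obtain N where N: "inverse (real (Suc N)) < 1 - norm z"
          using reals_Archimedean[of "1 - norm z"] by auto
        have "z \<notin> A n" if "n \<ge> N" for n
        proof -
          have "inverse (real (Suc n)) \<le> inverse (real (Suc N))" using that by (intro le_imp_inverse_le) auto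
          then show ?thesis using N unfolding A_def mem_Collect_eq by linarith
        qed
        then have "\<forall>\<^sub>F n in sequentially. U z * indicator (A n) z = 0"
          by (intro eventually_sequentiallyI[of N]) auto
        then show ?thesis by (rule tendsto_eventually)
      qed (simp add: U_def)
    qed
  qed (use finU in \<open>auto simp: indicator_def\<close>)
  then have "\<forall>\<^sub>F n in sequentially. (\<integral>\<^sup>+z. U z * indicator (A n) z \<partial>lborel) < ennreal \<eta>"
    using \<eta> by (intro order_tendstoD(2)[of _ 0]) auto
  then obtain n where n: "(\<integral>\<^sup>+z. U z * indicator (A n) z \<partial>lborel) < ennreal \<eta>"
    using eventually_happens[of _ sequentially] by auto
  \<comment> \<open>Half the width of the annulus suffices: t < inverse (Suc n) / 2 gives 1 - |u| <
    3t/2 < inverse (Suc n) throughout the small disc.\<close>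
  define \<rho> where "\<rho> = 1 - inverse (real (Suc n)) / 2"
  have "(1 - norm z) powr \<alpha> * norm (H z) powr p < \<epsilon>" if z: "\<rho> < norm z" "norm z < 1" for z
  proof -
    define t where "t = 1 - norm z"
    have t: "0 < t" "t < inverse (real (Suc n)) / 2" using z by (auto simp: t_def \<rho>_def)
    have B: "t / 2 < 1 - norm u \<and> 1 - norm u < 3 / 2 * t \<and> u \<in> unit_disc \<and> u \<in> A n" if "u \<in> ball z (t/2)" for u
    proof -
      have "norm (z - u) < t / 2" using that by (simp add: dist_norm)
      moreover have "norm u \<le> norm z + norm (z - u)" "norm z \<le> norm u + norm (z - u)"
        using norm_triangle_ineq4[of z "z - u"] norm_triangle_ineq[of u "z - u"] by auto
      ultimately show ?thesis using t by (auto simp: t_def A_def)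
    qed
    have w: "\<kappa> * t powr (\<alpha> - 2) \<le> (1 - norm u) powr (\<alpha> - 2)" if "u \<in> ball z (t/2)" for u
    proof (cases "\<alpha> \<ge> 2")
      case True
      have "\<kappa> * t powr (\<alpha> - 2) \<le> (1/2) powr (\<alpha> - 2) * t powr (\<alpha> - 2)"
        by (intro mult_right_mono) (auto simp: \<kappa>_def)
      also have "\<dots> = (t / 2) powr (\<alpha> - 2)" using t by (simp flip: powr_mult)
      also have "\<dots> \<le> (1 - norm u) powr (\<alpha> - 2)" using B[OF that] t True by (intro powr_mono2) auto
      finally show ?thesis .
    next
      case False
      have "\<kappa> * t powr (\<alpha> - 2) \<le> (3/2) powr (\<alpha> - 2) * t powr (\<alpha> - 2)"
        by (intro mult_right_mono) (auto simp: \<kappa>_def)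
      also have "\<dots> = (3 / 2 * t) powr (\<alpha> - 2)" using t by (simp flip: powr_mult)
      also have "\<dots> \<le> (1 - norm u) powr (\<alpha> - 2)" using B[OF that] t False by (intro powr_mono2') auto
      finally show ?thesis .
    qed
    have Hb: "H holomorphic_on ball z (t/2)" using H B by (blast intro: holomorphic_on_subset)
    have [measurable]: "(\<lambda>u. ennreal (norm (H u) powr p) * indicator (ball z (t/2)) u) \<in> borel_measurable borel"
    proof -
      have "(\<lambda>u. ennreal (norm (H u) powr p) * indicator (ball z (t/2)) u)
          = (\<lambda>u. ennreal (norm (H0 u) powr p) * indicator (ball z (t/2)) u)"
        using B by (auto simp: H0_def indicator_def fun_eq_iff)
      then show ?thesis by simp
    qed
    have "ennreal (\<kappa> * t powr (\<alpha> - 2)) * (ennreal (norm (H z) powr p) * emeasure lborel (ball z (t/2)))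
      \<le> ennreal (\<kappa> * t powr (\<alpha> - 2)) * (\<integral>\<^sup>+u\<in>ball z (t/2). ennreal (norm (H u) powr p) \<partial>lborel)"
      by (intro mult_left_mono area_mean_powr_ge Hb p) auto
    also have "\<dots> = (\<integral>\<^sup>+u. ennreal (\<kappa> * t powr (\<alpha> - 2)) * (ennreal (norm (H u) powr p) * indicator (ball z (t/2)) u) \<partial>lborel)"
      by (rule nn_integral_cmult[symmetric]) measurable
    also have "\<dots> \<le> (\<integral>\<^sup>+u. U u * indicator (A n) u \<partial>lborel)"
    proof (rule nn_integral_mono)
      fix u
      show "ennreal (\<kappa> * t powr (\<alpha> - 2)) * (ennreal (norm (H u) powr p) * indicator (ball z (t/2)) u)
         \<le> U u * indicator (A n) u"
      proof (cases "u \<in> ball z (t/2)")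
        case True
        then have "ennreal (\<kappa> * t powr (\<alpha> - 2) * norm (H u) powr p)
           \<le> ennreal ((1 - norm u) powr (\<alpha> - 2) * norm (H u) powr p)"
          by (intro ennreal_leI mult_right_mono w) auto
        then show ?thesis
          using True B[OF True] \<kappa> by (simp add: U_def H0_def ennreal_mult)
      qed simp
    qed
    also note n
    also have "emeasure lborel (ball z (t/2)) = ennreal (pi * (t/2)\<^sup>2)"
      using t by (simp add: emeasure_ball unit_ball_vol_2)
    finally have lt: "\<kappa> * t powr (\<alpha> - 2) * (norm (H z) powr p * (pi * (t/2)\<^sup>2)) < \<eta>"
      using \<kappa> \<eta> by (simp add: ennreal_mult[symmetric] ennreal_less_iff)
    have ta: "t powr \<alpha> = t powr (\<alpha> - 2) * t\<^sup>2"
      using t by (simp add: powr_diff powr_numeral)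
    have "(\<kappa> * pi / 4) * (t powr \<alpha> * norm (H z) powr p)
        = \<kappa> * t powr (\<alpha> - 2) * (norm (H z) powr p * (pi * (t/2)\<^sup>2))"
      unfolding ta by (simp add: power_divide)
    also note lt
    also have "\<eta> = (\<kappa> * pi / 4) * \<epsilon>" by (simp add: \<eta>_def)
    finally have "(\<kappa> * pi / 4) * (t powr \<alpha> * norm (H z) powr p) < (\<kappa> * pi / 4) * \<epsilon>" .
    then have "t powr \<alpha> * norm (H z) powr p < \<epsilon>"
      using \<kappa> by (subst (asm) mult_less_cancel_left_pos) auto
    then show ?thesis by (simp add: t_def)
  qed
  moreover have "\<rho> < 1" by (simp add: \<rho>_def)
  ultimately show ?thesis by blast
qed

text \<open>Along a radius, the bound (\<epsilon>/2) (1 - x)^(-2) for G' integrates to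
  (\<epsilon>/2) (1 - x)^(-1). The starting value on the circle of radius r is bounded by M, and the
  factor 1 - |z| makes it negligible.\<close>

lemma derivative_decay_imp_decay:
  assumes G: "G holomorphic_on unit_disc"
    and dec: "\<And>\<epsilon>. 0 < \<epsilon> \<Longrightarrow> \<exists>\<rho><1. \<forall>z. \<rho> < norm z \<and> norm z < 1 \<longrightarrow> (1 - norm z)\<^sup>2 * norm (deriv G z) < \<epsilon>"
    and \<epsilon>: "0 < (\<epsilon>::real)"
  shows "\<exists>\<rho><1. \<forall>z. \<rho> < norm z \<and> norm z < 1 \<longrightarrow> (1 - norm z) * norm (G z) < \<epsilon>"
proof -
  obtain \<rho>0 where \<rho>0: "\<rho>0 < 1"
    "\<And>z. \<rho>0 < norm z \<Longrightarrow> norm z < 1 \<Longrightarrow> (1 - norm z)\<^sup>2 * norm (deriv G z) < \<epsilon> / 2"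
    using dec[of "\<epsilon> / 2"] \<epsilon> by auto
  define r where "r = max (1/2) \<rho>0"
  have r: "0 < r" "r < 1" "\<rho>0 \<le> r" using \<rho>0 by (auto simp: r_def)
  have "compact (G ` cball 0 r)"
    using r G by (intro compact_continuous_image holomorphic_on_imp_continuous_on)
      (auto intro: holomorphic_on_subset)
  then have "bounded (G ` cball 0 r)" by (rule compact_imp_bounded)
  then obtain M where "0 < M" "\<forall>x\<in>G ` cball 0 r. norm x \<le> M"
    unfolding bounded_pos by blast
  then have M: "0 < M" "\<And>z. norm z \<le> r \<Longrightarrow> norm (G z) \<le> M" by auto
  \<comment> \<open>The second entry of the maximum ensures (1 - |z|) M < \<epsilon>/2.\<close>
  define \<rho> where "\<rho> = max r (1 - \<epsilon> / (2 * M))"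
  have "(1 - norm z) * norm (G z) < \<epsilon>" if z: "\<rho> < norm z" "norm z < 1" for z
  proof -
    define \<zeta> where "\<zeta> = z / norm z"
    have zr: "r < norm z" using z by (simp add: \<rho>_def)
    then have z0: "norm z > 0" using r by linarith
    then have \<zeta>: "norm \<zeta> = 1" "of_real (norm z) * \<zeta> = z" by (auto simp: \<zeta>_def norm_divide)
    define f where "f x = G (of_real x * \<zeta>)" for x :: real
    have f': "(f has_vector_derivative (\<zeta> * deriv G (of_real x * \<zeta>))) (at x)" if "0 \<le> x" "x < 1" for x
    proof -
      have "(G has_field_derivative deriv G (of_real x * \<zeta>)) (at (of_real x * \<zeta>))"
        using G that \<zeta> by (intro holomorphic_derivI[of G unit_disc]) (auto simp: norm_mult)
      moreover have "((\<lambda>x. of_real x * \<zeta>) has_vector_derivative \<zeta>) (at x)"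
        by (auto intro!: derivative_eq_intros)
      ultimately show ?thesis
        using field_vector_diff_chain_at[of "\<lambda>x. of_real x * \<zeta>" \<zeta> x G]
        unfolding f_def o_def by blast
    qed
    have "norm (f (norm z) - f r) \<le> \<epsilon> / 2 / (1 - norm z) - \<epsilon> / 2 / (1 - r)"
    proof (rule differentiable_bound_general[where f' = "\<lambda>x. \<zeta> * deriv G (of_real x * \<zeta>)" and
          \<phi>' = "\<lambda>x. \<epsilon> / 2 / (1 - x)\<^sup>2" and \<phi> = "\<lambda>x. \<epsilon> / 2 / (1 - x)"])
      show "continuous_on {r..norm z} f"
        using r z
        by (intro continuous_at_imp_continuous_on ballI has_vector_derivative_continuous[OF f']) auto
      show "continuous_on {r..norm z} (\<lambda>x. \<epsilon> / 2 / (1 - x))"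
        using z by (intro continuous_intros) auto
      fix x assume x: "r < x" "x < norm z"
      show "(f has_vector_derivative \<zeta> * deriv G (of_real x * \<zeta>)) (at x)"
        using f' x r z by auto
      show "((\<lambda>x. \<epsilon> / 2 / (1 - x)) has_vector_derivative \<epsilon> / 2 / (1 - x)\<^sup>2) (at x)"
        unfolding has_real_derivative_iff_has_vector_derivative[symmetric]
        using DERIV_divide[OF DERIV_const DERIV_diff[OF DERIV_const DERIV_ident], of 1 x "\<epsilon> / 2"] x z
        by (simp add: power2_eq_square)
      have "norm (of_real x * \<zeta>) = x" using x r \<zeta> by (simp add: norm_mult)
      then have "(1 - x)\<^sup>2 * norm (deriv G (of_real x * \<zeta>)) < \<epsilon> / 2"
        using \<rho>0(2)[of "of_real x * \<zeta>"] x r z by simp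
      then show "norm (\<zeta> * deriv G (of_real x * \<zeta>)) \<le> \<epsilon> / 2 / (1 - x)\<^sup>2"
        using x z \<zeta> by (simp add: norm_mult field_simps)
    qed (rule zr)
    then have "norm (G z - f r) \<le> \<epsilon> / 2 / (1 - norm z)"
      using r \<epsilon> \<zeta> by (simp add: f_def) (smt (verit) divide_nonneg_pos)
    moreover have "norm (f r) \<le> M" using M(2)[of "of_real r * \<zeta>"] \<zeta> r by (simp add: f_def norm_mult)
    ultimately have "norm (G z) \<le> M + \<epsilon> / 2 / (1 - norm z)"
      using norm_triangle_ineq2[of "G z" "f r"] by linarith
    then have "(1 - norm z) * norm (G z) \<le> (1 - norm z) * (M + \<epsilon> / 2 / (1 - norm z))"
      using z by (intro mult_left_mono) auto
    also have "\<dots> = (1 - norm z) * M + \<epsilon> / 2" using z by (simp add: field_simps)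
    also have "(1 - norm z) * M < \<epsilon> / 2"
      using z M by (simp add: \<rho>_def field_simps)
    finally show ?thesis by simp
  qed
  moreover have "\<rho> < 1" using r M \<epsilon> by (simp add: \<rho>_def)
  ultimately show ?thesis by blast
qed

section \<open>From the normalized area integrals of Besov functions to boundary decay\<close>

lemma nn_integral_disc_area:
  assumes "(\<lambda>z. f z * indicator unit_disc z) \<in> borel_measurable borel"
  shows "(\<integral>\<^sup>+z\<in>unit_disc. f z \<partial>disc_area) = (\<integral>\<^sup>+z\<in>unit_disc. f z \<partial>lborel) / ennreal pi"
proof -
  have "(\<integral>\<^sup>+z\<in>unit_disc. f z \<partial>disc_area)
      = (\<integral>\<^sup>+z\<in>unit_disc. (f z * indicator unit_disc z) \<partial>lborel) / ennreal pi"
    unfolding disc_area_def using assms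
    by (subst nn_integral_uniform_measure) (auto simp: emeasure_ball unit_ball_vol_2)
  also have "(\<integral>\<^sup>+z\<in>unit_disc. (f z * indicator unit_disc z) \<partial>lborel) = (\<integral>\<^sup>+z\<in>unit_disc. f z \<partial>lborel)"
    by (intro nn_integral_cong) (auto simp: indicator_def)
  finally show ?thesis .
qed

lemma borel_measurable_holomorphic_indicator:
  assumes "H holomorphic_on S" "open S"
  shows "(\<lambda>z. indicator S z *\<^sub>R H z) \<in> borel_measurable borel"
  using assms
  by (intro borel_measurable_continuous_on_indicator holomorphic_on_imp_continuous_on) auto

lemma ennreal_divide_less_topD:
  fixes x :: ennreal
  assumes "x / ennreal c < \<infinity>"
  shows "x < \<infinity>"
proof (rule ccontr)
  assume "\<not> x < \<infinity>"
  then have "x = top" using less_top[of x] by simp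
  then show False using assms by (simp add: ennreal_top_divide)
qed

text \<open>For p = 1, \<open>weighted_integral_decay\<close> with \<alpha> = 2 gives decay of h'',
  which is integrated radially. For p > 1 it is applied to h' with \<alpha> = p, and p-th powers are
  compared.\<close>

lemma Besov_decay:
  assumes p: "1 \<le> p" and h: "h \<in> Besov p" and \<epsilon>: "0 < \<epsilon>"
  shows "\<exists>\<rho><1. \<forall>z. \<rho> < norm z \<and> norm z < 1 \<longrightarrow> (1 - norm z) * norm (deriv h z) < \<epsilon>"
proof (cases "p = 1")
  case True
  have holh: "h holomorphic_on unit_disc" using h by (simp add: Besov_def)
  have hol: "deriv h holomorphic_on unit_disc" "deriv (deriv h) holomorphic_on unit_disc"
    using holh by (auto intro!: holomorphic_deriv)
  show ?thesis
  proof (rule derivative_decay_imp_decay[OF hol(1) _ \<epsilon>])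
    fix \<epsilon>' :: real assume \<epsilon>': "0 < \<epsilon>'"
    have m: "(\<lambda>z. ennreal (norm (deriv (deriv h) z)) * indicator unit_disc z) \<in> borel_measurable borel"
    proof -
      note [measurable] = borel_measurable_holomorphic_indicator[OF hol(2) open_ball]
      have "(\<lambda>z. ennreal (norm (indicator unit_disc z *\<^sub>R deriv (deriv h) z))) \<in> borel_measurable borel"
        by measurable
      also have "(\<lambda>z. ennreal (norm (indicator unit_disc z *\<^sub>R deriv (deriv h) z)))
          = (\<lambda>z. ennreal (norm (deriv (deriv h) z)) * indicator unit_disc z)"
        by (auto simp: indicator_def fun_eq_iff)
      finally show ?thesis .
    qed
    have "(\<integral>\<^sup>+z\<in>unit_disc. ennreal (norm (deriv (deriv h) z)) \<partial>lborel) / ennreal pi < \<infinity>"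
      using h True nn_integral_disc_area[OF m] by (simp add: Besov_def)
    then have "(\<integral>\<^sup>+z\<in>unit_disc. ennreal (norm (deriv (deriv h) z)) \<partial>lborel) < \<infinity>"
      by (rule ennreal_divide_less_topD)
    also have "(\<integral>\<^sup>+z\<in>unit_disc. ennreal (norm (deriv (deriv h) z)) \<partial>lborel)
      = (\<integral>\<^sup>+z\<in>unit_disc. ennreal ((1 - norm z) powr (2 - 2) * norm (deriv (deriv h) z) powr 1) \<partial>lborel)"
      by (intro nn_integral_cong) (auto simp: indicator_def)
    finally have "\<exists>\<rho><1. \<forall>z. \<rho> < norm z \<and> norm z < 1 \<longrightarrow>
        (1 - norm z) powr 2 * norm (deriv (deriv h) z) powr 1 < \<epsilon>'"
      using weighted_integral_decay[OF hol(2), of 1 2 \<epsilon>'] \<epsilon>' by simp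
    then show "\<exists>\<rho><1. \<forall>z. \<rho> < norm z \<and> norm z < 1 \<longrightarrow>
        (1 - norm z)\<^sup>2 * norm (deriv (deriv h) z) < \<epsilon>'"
      by (simp add: powr_numeral cong: conj_cong)
  qed
next
  case False
  have holh: "h holomorphic_on unit_disc" using h by (simp add: Besov_def)
  have hol: "deriv h holomorphic_on unit_disc"
    using holh by (auto intro!: holomorphic_deriv)
  let ?u = "\<lambda>z. ennreal ((1 - norm z) powr (p - 2) * norm (deriv h z) powr p)"
  have m: "(\<lambda>z. ?u z * indicator unit_disc z) \<in> borel_measurable borel"
  proof -
    note [measurable] = borel_measurable_holomorphic_indicator[OF hol open_ball]
    have "(\<lambda>z. ennreal ((1 - norm z) powr (p - 2) * norm (indicator unit_disc z *\<^sub>R deriv h z) powr p)) \<in> borel_measurable borel"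
      by measurable
    also have "(\<lambda>z. ennreal ((1 - norm z) powr (p - 2) * norm (indicator unit_disc z *\<^sub>R deriv h z) powr p))
        = (\<lambda>z. ?u z * indicator unit_disc z)"
      using p by (auto simp: indicator_def fun_eq_iff)
    finally show ?thesis .
  qed
  have "(\<integral>\<^sup>+z\<in>unit_disc. ?u z \<partial>lborel) / ennreal pi < \<infinity>"
    using h False nn_integral_disc_area[OF m] by (simp add: Besov_def)
  then have fin: "(\<integral>\<^sup>+z\<in>unit_disc. ?u z \<partial>lborel) < \<infinity>"
    by (rule ennreal_divide_less_topD)
  obtain \<rho> where \<rho>: "\<rho> < 1"
    "\<And>z. \<rho> < norm z \<Longrightarrow> norm z < 1 \<Longrightarrow> (1 - norm z) powr p * norm (deriv h z) powr p < \<epsilon> powr p"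
    using weighted_integral_decay[OF hol p fin, of "\<epsilon> powr p"] \<epsilon> by auto
  have "(1 - norm z) * norm (deriv h z) < \<epsilon>" if "\<rho> < norm z" "norm z < 1" for z
  proof (rule ccontr)
    assume "\<not> ?thesis"
    then have "\<epsilon> powr p \<le> ((1 - norm z) * norm (deriv h z)) powr p"
      using \<epsilon> p by (intro powr_mono2) auto
    also have "\<dots> = (1 - norm z) powr p * norm (deriv h z) powr p"
      using that by (simp add: powr_mult)
    finally show False using \<rho>(2)[OF that] by simp
  qed
  then show ?thesis using \<rho>(1) by blast
qed

subsection \<open>A sparse sum of disc automorphisms\<close>

definition bump :: "complex \<Rightarrow> complex \<Rightarrow> complex"
  where "bump w z = w - disc_involution w z"

text \<open>\<open>bump w\<close> is \<open>(1 - \<bar>w\<bar>\<^sup>2) z / (1 - cnj w z)\<close>; unlike \<open>disc_involution w\<close> it vanishes at \<open>0\<close>, so that sums converge.\<close>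
definition bump_deriv :: "complex \<Rightarrow> complex \<Rightarrow> complex"
  where "bump_deriv w z = (1 - (norm w)\<^sup>2) / (1 - cnj w * z)\<^sup>2"

lemma has_field_derivative_bump:
  assumes "norm w < 1" "norm z < 1"
  shows "(bump w has_field_derivative bump_deriv w z) (at z)"
  unfolding bump_def
  using DERIV_diff[OF DERIV_const has_field_derivative_disc_involution[OF assms], of w]
  by (simp add: bump_deriv_def minus_divide_left del: divide_minus_left)

lemma norm_deriv_disc_involution:
  assumes "norm w < 1" "norm z < 1"
  shows "norm (deriv (disc_involution w) z) = norm (bump_deriv w z)"
  unfolding DERIV_imp_deriv[OF has_field_derivative_disc_involution[OF assms]] bump_deriv_def
  by (simp add: norm_divide norm_minus_commute)

text \<open>This is the reverse triangle inequality, with |w||z| at most |w| and at most |z|.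
  Keeping both bounds yields decay whether z is much nearer to the circle than w or much farther
  from it.\<close>

lemma norm_one_minus_cnj_mult_ge:
  assumes "norm w < 1" "norm z < 1"
  shows "max (1 - norm w) (1 - norm z) \<le> norm (1 - cnj w * z)"
proof -
  have "1 - norm w * norm z \<le> norm (1 - cnj w * z)"
    using norm_triangle_ineq2[of 1 "cnj w * z"] by (simp add: norm_mult)
  moreover have "norm w * norm z \<le> norm w" "norm w * norm z \<le> norm z"
    using assms by (auto simp: mult_left_le mult_left_le_one_le)
  ultimately show ?thesis by linarith
qed

lemma one_minus_square_le:
  fixes x :: real
  assumes "0 \<le> x" "x < 1"
  shows "1 - x\<^sup>2 \<le> 2 * (1 - x)" "0 < 1 - x\<^sup>2"
proof -
  have "1 - x\<^sup>2 = (1 + x) * (1 - x)" by (simp add: power2_eq_square algebra_simps)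
  moreover have "(1 + x) * (1 - x) \<le> 2 * (1 - x)" using assms by (intro mult_right_mono) auto
  ultimately show "1 - x\<^sup>2 \<le> 2 * (1 - x)" by simp
  show "0 < 1 - x\<^sup>2" using assms by (simp add: abs_square_less_1)
qed

lemma norm_bump_deriv_le:
  assumes "norm w < 1" "norm z < 1"
  shows "norm (bump_deriv w z) \<le> 2 * (1 - norm w) / (max (1 - norm w) (1 - norm z))\<^sup>2"
proof -
  have "norm (bump_deriv w z) = (1 - (norm w)\<^sup>2) / (norm (1 - cnj w * z))\<^sup>2"
    using one_minus_square_le(2)[of "norm w"] assms
    unfolding bump_deriv_def norm_divide norm_power
    by (metis abs_of_pos norm_ge_zero norm_of_real of_real_1 of_real_diff)
  also have "\<dots> \<le> 2 * (1 - norm w) / (max (1 - norm w) (1 - norm z))\<^sup>2"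
    using assms norm_one_minus_cnj_mult_ge[OF assms] one_minus_square_le[of "norm w"]
    by (intro frac_le power_mono) auto
  finally show ?thesis .
qed

text \<open>In \<open>norm_bump_series_le\<close> the first bound serves the summands with index up
  to n, and the second gives geometric decay for the later ones.\<close>

lemma norm_bump_le:
  assumes "norm w < 1" "norm z < 1"
  shows "norm (bump w z) \<le> 2" "norm (bump w z) \<le> 2 * ((1 - norm w) / (1 - norm z))"
proof -
  show "norm (bump w z) \<le> 2"
    unfolding bump_def
    using norm_triangle_ineq4[of w "disc_involution w z"] norm_disc_involution_less_one[OF assms] assms
    by linarith
  have n: "1 - cnj w * z \<noteq> 0" by (rule one_minus_cnj_mult_nonzero[OF assms])
  have "bump w z = (1 - cnj w * w) * z / (1 - cnj w * z)"
    using n by (simp add: bump_def disc_involution_def field_simps)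
  also have "1 - cnj w * w = of_real (1 - (norm w)\<^sup>2)"
    by (simp add: complex_norm_square mult.commute flip: of_real_power)
  finally have eq: "bump w z = of_real (1 - (norm w)\<^sup>2) * z / (1 - cnj w * z)" .
  have "norm (bump w z) = (1 - (norm w)\<^sup>2) * norm z / norm (1 - cnj w * z)"
    using one_minus_square_le(2)[of "norm w"] assms
    unfolding eq norm_divide norm_mult norm_of_real by simp
  also have "\<dots> \<le> (2 * (1 - norm w)) * 1 / (1 - norm z)"
    using assms norm_one_minus_cnj_mult_ge[OF assms] one_minus_square_le[of "norm w"]
    by (intro frac_le mult_mono) auto
  finally show "norm (bump w z) \<le> 2 * ((1 - norm w) / (1 - norm z))" by simp
qed

lemma mult_divide_max_square:
  fixes x y :: real
  assumes "0 < x" "0 < y"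
  shows "x * y / (max x y)\<^sup>2 = min (x / y) (y / x)"
proof (cases "x \<le> y")
  case True
  then have "x / y \<le> y / x" using assms by (intro frac_le) auto
  then show ?thesis using True assms by (simp add: max_def min_def power2_eq_square field_simps)
next
  case False
  then have "y / x \<le> x / y" using assms by (intro frac_le) auto
  then show ?thesis using False assms by (auto simp: max_def min_def power2_eq_square field_simps)
qed

text \<open>The Schwarz-Pick identity and the two lower bounds for the denominator leave only the
  ratio of the distances of w and a to the circle. The estimate is small unless these distances are
  comparable.\<close>

lemma one_minus_disc_involution_square_le:
  assumes "norm w < 1" "norm a < 1"
  shows "1 - (norm (disc_involution w a))\<^sup>2
    \<le> 4 * min ((1 - norm w) / (1 - norm a)) ((1 - norm a) / (1 - norm w))"
proof -
  define t \<delta> where "t = 1 - norm w" and "\<delta> = 1 - norm a"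
  have t: "0 < t" "0 < \<delta>" using assms by (auto simp: t_def \<delta>_def)
  have "1 - (norm (disc_involution w a))\<^sup>2 \<le> (2 * t) * (2 * \<delta>) / (max t \<delta>)\<^sup>2"
    unfolding one_minus_disc_involution_square[OF assms] t_def \<delta>_def
    using assms norm_one_minus_cnj_mult_ge[OF assms] one_minus_square_le[of "norm w"]
      one_minus_square_le[of "norm a"]
    by (intro frac_le mult_mono power_mono) auto
  also have "\<dots> = 4 * min (t / \<delta>) (\<delta> / t)"
    using mult_divide_max_square[OF t] by simp
  finally show ?thesis by (simp add: t_def \<delta>_def)
qed

section \<open>Two-sided geometric sums and a weighted Cauchy-Schwarz inequality\<close>

text \<open>With truncated subtraction, \<open>(n - N) + (N - n)\<close> is the distance \<open>\<bar>n - N\<bar>\<close>.\<close>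
lemma sum_power_dist_le:
  fixes \<theta> :: real
  assumes "0 \<le> \<theta>" "\<theta> < 1"
  shows "(\<Sum>n<m. \<theta> ^ ((n - N) + (N - n))) \<le> 2 / (1 - \<theta>)"
proof -
  have geo: "(\<Sum>n<k. \<theta> ^ n) \<le> 1 / (1 - \<theta>)" for k
    using sum_le_suminf[of "\<lambda>n. \<theta> ^ n" "{..<k}"] assms suminf_geometric[of \<theta>] summable_geometric[of \<theta>]
    by simp
  have "(\<Sum>n<m. \<theta> ^ ((n - N) + (N - n))) \<le> (\<Sum>n\<in>{..<N} \<union> {N..<N + m}. \<theta> ^ ((n - N) + (N - n)))"
    using assms by (intro sum_mono2) auto
  also have "\<dots> = (\<Sum>n<N. \<theta> ^ ((n - N) + (N - n))) + (\<Sum>n\<in>{N..<N + m}. \<theta> ^ ((n - N) + (N - n)))"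
    by (intro sum.union_disjoint) auto
  also have "(\<Sum>n<N. \<theta> ^ ((n - N) + (N - n))) = (\<Sum>n<N. \<theta> ^ Suc n)"
    by (subst sum.nat_diff_reindex[symmetric]) (auto intro!: sum.cong)
  also have "\<dots> \<le> (\<Sum>n<N. \<theta> ^ n)"
    using assms by (intro sum_mono) (auto simp: mult_left_le_one_le)
  also have "(\<Sum>n\<in>{N..<N + m}. \<theta> ^ ((n - N) + (N - n))) = (\<Sum>n<m. \<theta> ^ n)"
    by (subst sum.atLeastLessThan_shift_0) (auto simp: atLeast0LessThan)
  finally show ?thesis using geo[of N] geo[of m] by simp
qed

lemma norm_suminf_le_bound:
  fixes f :: "nat \<Rightarrow> 'a :: banach"
  assumes "summable f" "\<And>m. (\<Sum>k<m. norm (f k)) \<le> B"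
  shows "norm (suminf f) \<le> B"
proof -
  have "(\<lambda>m. norm (\<Sum>k<m. f k)) \<longlonglongrightarrow> norm (suminf f)"
    using summable_LIMSEQ[OF assms(1)] by (rule tendsto_norm)
  moreover have "norm (\<Sum>k<m. f k) \<le> B" for m
    using norm_sum[of f "{..<m}"] assms(2)[of m] by linarith
  ultimately show ?thesis by (intro LIMSEQ_le_const2) auto
qed

text \<open>Cauchy-Schwarz after splitting each norm as sqrt (d n) times its quotient by sqrt (d n).
  With geometric weights the cross terms of the squared sum cost only a constant.\<close>

lemma norm_sum_square_le_weighted:
  fixes x :: "'i \<Rightarrow> 'a :: real_normed_vector"
  assumes "\<And>n. n \<in> A \<Longrightarrow> 0 < d n"
  shows "(norm (\<Sum>n\<in>A. x n))\<^sup>2 \<le> (\<Sum>n\<in>A. d n) * (\<Sum>n\<in>A. (norm (x n))\<^sup>2 / d n)"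
proof -
  have "(norm (\<Sum>n\<in>A. x n))\<^sup>2 \<le> (\<Sum>n\<in>A. norm (x n))\<^sup>2"
    by (intro power_mono norm_sum) auto
  also have "(\<Sum>n\<in>A. norm (x n)) = (\<Sum>n\<in>A. sqrt (d n) * (norm (x n) / sqrt (d n)))"
    using assms by (intro sum.cong) (auto dest: assms)
  also have "\<dots>\<^sup>2 \<le> (\<Sum>n\<in>A. (sqrt (d n))\<^sup>2) * (\<Sum>n\<in>A. (norm (x n) / sqrt (d n))\<^sup>2)"
    by (rule Cauchy_Schwarz_ineq_sum)
  also have "(\<Sum>n\<in>A. (sqrt (d n))\<^sup>2) = (\<Sum>n\<in>A. d n)"
    using assms by (intro sum.cong) (auto dest: assms less_imp_le)
  also have "(\<Sum>n\<in>A. (norm (x n) / sqrt (d n))\<^sup>2) = (\<Sum>n\<in>A. (norm (x n))\<^sup>2 / d n)"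
    using assms by (intro sum.cong) (auto simp: power_divide dest: assms less_imp_le)
  finally show ?thesis .
qed

lemma Q_spaceI:
  assumes F: "F holomorphic_on unit_disc"
    and B: "\<And>a. norm a < 1 \<Longrightarrow>
      (\<integral>\<^sup>+z\<in>unit_disc. ennreal ((norm (deriv F z))\<^sup>2 * Green z a powr s) \<partial>lborel) \<le> ennreal B"
  shows "F \<in> Q_space s"
proof -
  have hol: "deriv F holomorphic_on unit_disc" using F by (auto intro!: holomorphic_deriv)
  note [measurable] = borel_measurable_holomorphic_indicator[OF hol open_ball]
  have m: "(\<lambda>z. ennreal ((norm (deriv F z))\<^sup>2 * Green z a powr s) * indicator unit_disc z) \<in> borel_measurable borel" for a
  proof -
    have "(\<lambda>z. ennreal ((norm (indicator unit_disc z *\<^sub>R deriv F z))\<^sup>2 * Green z a powr s)) \<in> borel_measurable borel"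
      by measurable
    also have "(\<lambda>z. ennreal ((norm (indicator unit_disc z *\<^sub>R deriv F z))\<^sup>2 * Green z a powr s))
       = (\<lambda>z. ennreal ((norm (deriv F z))\<^sup>2 * Green z a powr s) * indicator unit_disc z)"
      by (auto simp: indicator_def fun_eq_iff)
    finally show ?thesis .
  qed
  have "(SUP a\<in>unit_disc. \<integral>\<^sup>+ z\<in>unit_disc. ennreal ((norm (deriv F z))\<^sup>2 * Green z a powr s) \<partial>disc_area)
      \<le> ennreal B / ennreal pi"
    using B by (intro SUP_least) (simp add: nn_integral_disc_area[OF m] divide_right_mono_ennreal)
  also have "\<dots> < \<infinity>"
    by (simp add: ennreal_divide_eq_top_iff less_top[symmetric])
  finally show ?thesis using F by (simp add: Q_space_def)
qed

text \<open>The ratio 64 serves \<open>norm_deriv_bump_series_ge\<close>, where the off-diagonal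
  summands together must stay below half of the diagonal one.\<close>

locale sparse_sequence =
  fixes w :: "nat \<Rightarrow> complex"
  assumes in_disc: "norm (w n) < 1"
    and sparse: "1 - norm (w (Suc n)) \<le> (1 - norm (w n)) / 64"
begin

abbreviation t :: "nat \<Rightarrow> real" where "t n \<equiv> 1 - norm (w n)"

lemma t_pos: "0 < t n"
  using in_disc by simp

lemma t_add_le: "t (n + k) \<le> t n * (1/64) ^ k"
proof (induction k)
  case (Suc k)
  then show ?case using sparse[of "n + k"] by simp
qed simp

lemma t_le: "t n \<le> (1/64) ^ n"
proof -
  have "t n \<le> t 0 * (1/64) ^ n" using t_add_le[of 0 n] by simp
  also have "\<dots> \<le> 1 * (1/64) ^ n" by (intro mult_right_mono) auto
  finally show ?thesis by simp
qed

lemma min_ratio_le: "min (t k / t n) (t n / t k) \<le> (1/64) ^ ((k - n) + (n - k))"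
proof (cases "n \<le> k")
  case True
  then have "t k \<le> t n * (1/64) ^ (k - n)" using t_add_le[of n "k - n"] by simp
  then have "t k / t n \<le> (1/64) ^ (k - n)" using t_pos[of n] by (simp add: field_simps)
  then show ?thesis using True by simp
next
  case False
  then have "t n \<le> t k * (1/64) ^ (n - k)" using t_add_le[of k "n - k"] by simp
  then have "t n / t k \<le> (1/64) ^ (n - k)" using t_pos[of k] by (simp add: field_simps)
  then show ?thesis using False by simp
qed

text \<open>N is the first index with t N \<le> \<delta>. From N on, t n falls geometrically below
  \<delta>; before N, \<delta> is geometrically small against t n. The factor 2 pays for a shift by
  one: below N the comparison is with t (N - 1).\<close>

lemma min_ratio_scale_le:
  assumes "0 < \<delta>"
  obtains N where "\<And>n. min (t n / \<delta>) (\<delta> / t n) \<le> 2 * (1/2) ^ ((n - N) + (N - n))"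
proof -
  obtain n where "(1/64) ^ n < \<delta>" using real_arch_pow_inv[of \<delta> "1/64"] assms by auto
  then have ex: "\<exists>n. t n \<le> \<delta>" using t_le[of n] by (intro exI[of _ n]) auto
  define N where "N = (LEAST n. t n \<le> \<delta>)"
  have N: "t N \<le> \<delta>" unfolding N_def using ex by (rule LeastI_ex)
  show ?thesis
  proof
    fix n
    show "min (t n / \<delta>) (\<delta> / t n) \<le> 2 * (1/2) ^ ((n - N) + (N - n))"
    proof (cases "N \<le> n")
      case True
      have "t n \<le> t N * (1/64) ^ (n - N)" using t_add_le[of N "n - N"] True by simp
      also have "\<dots> \<le> \<delta> * (1/2) ^ (n - N)"
        using N assms by (intro mult_mono power_mono) auto
      finally have "t n / \<delta> \<le> (1/2) ^ (n - N)" using assms by (simp add: field_simps)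
      also have "\<dots> \<le> 2 * (1/2) ^ (n - N)" by simp
      finally show ?thesis using True by simp
    next
      case False
      then obtain j where j: "N = n + Suc j" using less_imp_Suc_add[of n N] by auto
      have "\<not> t (n + j) \<le> \<delta>"
        using not_less_Least[of "n + j" "\<lambda>n. t n \<le> \<delta>"] j by (simp add: N_def)
      then have "\<delta> \<le> t n * (1/64) ^ j" using t_add_le[of n j] by linarith
      also have "\<dots> \<le> t n * (1/2) ^ j" using t_pos[of n] by (intro mult_left_mono power_mono) auto
      finally have "\<delta> / t n \<le> (1/2) ^ j" using t_pos[of n] by (simp add: field_simps)
      also have "\<dots> = 2 * (1/2) ^ (N - n)" using j by simp
      finally show ?thesis using False by simp
    qed
  qed
qed

definition bump_series :: "complex \<Rightarrow> complex" where "bump_series z = (\<Sum>n. bump (w n) z)"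

text \<open>On a disc of radius r < 1 the derivatives are bounded by a constant times 64^(-n), so
  they converge uniformly by the Weierstrass test. The series itself converges at 0, where every
  bump vanishes, and termwise differentiation follows.\<close>

lemma bump_series_props:
  assumes z: "norm z < 1"
  shows "summable (\<lambda>n. bump (w n) z)"
    and "summable (\<lambda>n. bump_deriv (w n) z)"
    and "(bump_series has_field_derivative (\<Sum>n. bump_deriv (w n) z)) (at z)"
proof -
  obtain r where r: "norm z < r" "r < 1" using dense z by blast
  have r0: "0 < r" using r norm_ge_zero[of z] by linarith
  have bound: "norm (bump_deriv (w n) u) \<le> 2 / (1 - r)\<^sup>2 * (1/64) ^ n" if "u \<in> ball 0 r" for n u
  proof -
    have u: "norm u < 1" "norm u < r" using that r by auto
    have "norm (bump_deriv (w n) u) \<le> 2 * t n / (max (t n) (1 - norm u))\<^sup>2"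
      by (rule norm_bump_deriv_le[OF in_disc u(1)])
    also have "\<dots> \<le> 2 * (1/64) ^ n / (1 - r)\<^sup>2"
      using u r t_le[of n] by (intro frac_le mult_left_mono power_mono) auto
    finally show ?thesis by simp
  qed
  have sm: "summable (\<lambda>n. 2 / (1 - r)\<^sup>2 * (1/64) ^ n :: real)"
    by (intro summable_mult summable_geometric) auto
  show "summable (\<lambda>n. bump_deriv (w n) z)"
    using bound[of z] r by (intro summable_comparison_test'[OF sm, of 0]) auto
  have uc: "uniformly_convergent_on (ball 0 r) (\<lambda>n u. \<Sum>i<n. bump_deriv (w i) u)"
    using bound by (intro Weierstrass_m_test'[OF _ sm]) auto
  have d: "(bump (w n) has_field_derivative bump_deriv (w n) u) (at u within ball 0 r)" if "u \<in> ball 0 r" for n u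
    using that r
    by (intro has_field_derivative_at_within[OF has_field_derivative_bump[OF in_disc]]) auto
  have s0: "summable (\<lambda>n. bump (w n) 0)"
    by (simp add: bump_def disc_involution_def)
  have zi: "0 \<in> ball (0::complex) r" "z \<in> interior (ball 0 r)"
    using r r0 by (auto simp: interior_open)
  note ser = has_field_derivative_series'[where S = "ball 0 r" and f = "\<lambda>n. bump (w n)"
      and f' = "\<lambda>n. bump_deriv (w n)", OF convex_ball d uc zi(1) s0 zi(2)]
  show "summable (\<lambda>n. bump (w n) z)" by (rule ser(1))
  have "bump_series = (\<lambda>z. \<Sum>n. bump (w n) z)" by (simp add: bump_series_def fun_eq_iff)
  then show "(bump_series has_field_derivative (\<Sum>n. bump_deriv (w n) z)) (at z)" using ser(2) by simp
qed

lemma holomorphic_bump_series: "bump_series holomorphic_on unit_disc"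
  unfolding holomorphic_on_open[OF open_ball]
  by (intro ballI exI, rule bump_series_props(3)) simp

lemma deriv_bump_series: "norm z < 1 \<Longrightarrow> deriv bump_series z = (\<Sum>n. bump_deriv (w n) z)"
  by (intro DERIV_imp_deriv bump_series_props(3))

lemma bump_deriv_measurable [measurable]: "bump_deriv v \<in> borel_measurable borel"
  unfolding bump_deriv_def by measurable

text \<open>For fixed a, the n-th summand has weighted energy at most C' (d n)^2, where d n is
  \<theta> to the power |n - N| and N depends on a. Cauchy-Schwarz with weights d n bounds the
  energy of every partial sum by (\<Sum> d n) (\<Sum> C' d n) \<le> D C' D, uniformly in a. Fatou's
  lemma passes to the full series.\<close>

lemma bump_series_in_Q_space:
  assumes s: "0 < s"
  shows "bump_series \<in> Q_space s"
proof -
  define \<sigma> where "\<sigma> = min s (1/2)"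
  have \<sigma>: "0 < \<sigma>" "\<sigma> \<le> 1/2" using s by (auto simp: \<sigma>_def)
  obtain C where C: "0 < C" "\<And>b. norm b < 1 \<Longrightarrow>
      (\<integral>\<^sup>+u\<in>unit_disc. ennreal (Green u b powr s) \<partial>lborel) \<le> ennreal (C * (1 - (norm b)\<^sup>2) powr \<sigma>)"
    using nn_integral_Green_powr_le[OF s] unfolding \<sigma>_def by blast
  \<comment> \<open>The square of \<theta> is (1/2)^\<sigma>, so the decay of the n-th energy is
    exactly (d n)^2: one factor pays for the Cauchy-Schwarz weight, the other remains
    summable.\<close>
  define \<theta> :: real where "\<theta> = (1/2) powr (\<sigma> / 2)"
  have \<theta>: "0 < \<theta>" "\<theta> < 1" using \<sigma> powr_less_mono2[of "\<sigma> / 2" "1/2" 1] by (auto simp: \<theta>_def)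
  define D where "D = 2 / (1 - \<theta>)"
  have D: "0 < D" using \<theta> by (simp add: D_def)
  \<comment> \<open>8 is the product of the 4 in \<open>one_minus_disc_involution_square_le\<close>
    and the 2 in \<open>min_ratio_scale_le\<close>.\<close>
  define C' where "C' = C * 8 powr \<sigma>"
  have C': "0 < C'" using C by (simp add: C'_def)
  show ?thesis
  proof (rule Q_spaceI[OF holomorphic_bump_series])
    fix a :: complex assume a: "norm a < 1"
    define \<delta> where "\<delta> = 1 - norm a"
    have \<delta>: "0 < \<delta>" using a by (simp add: \<delta>_def)
    obtain N where N: "\<And>n. min (t n / \<delta>) (\<delta> / t n) \<le> 2 * (1/2) ^ ((n - N) + (N - n))"
      using min_ratio_scale_le[OF \<delta>] by blast
    define d where "d n = \<theta> ^ ((n - N) + (N - n))" for n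
    have d: "0 < d n" for n using \<theta> by (simp add: d_def)
    have sd: "(\<Sum>n<m. d n) \<le> D" for m
      unfolding d_def D_def using \<theta> by (intro sum_power_dist_le) auto
    have E: "(\<integral>\<^sup>+z\<in>unit_disc. ennreal ((norm (bump_deriv (w n) z))\<^sup>2 * Green z a powr s) \<partial>lborel)
        \<le> ennreal (C' * (d n)\<^sup>2)" for n
    proof -
      have na: "norm (disc_involution (w n) a) < 1"
        by (rule norm_disc_involution_less_one[OF in_disc a])
      have "(\<integral>\<^sup>+z\<in>unit_disc. ennreal ((norm (bump_deriv (w n) z))\<^sup>2 * Green z a powr s) \<partial>lborel)
        = (\<integral>\<^sup>+z\<in>unit_disc. ennreal ((norm (deriv (disc_involution (w n)) z))\<^sup>2 * Green z a powr s) \<partial>lborel)"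
        by (intro nn_integral_cong) (auto simp: norm_deriv_disc_involution[OF in_disc] indicator_def)
      also have "\<dots> \<le> ennreal (C * (1 - (norm (disc_involution (w n) a))\<^sup>2) powr \<sigma>)"
        unfolding nn_integral_disc_involution_Green[OF in_disc a] by (rule C(2)[OF na])
      also have "\<dots> \<le> ennreal (C' * (d n)\<^sup>2)"
      proof (rule ennreal_leI)
        have "1 - (norm (disc_involution (w n) a))\<^sup>2 \<le> 8 * (1/2) ^ ((n - N) + (N - n))"
          using one_minus_disc_involution_square_le[OF in_disc a, of n] N[of n] by (simp add: \<delta>_def)
        then have "(1 - (norm (disc_involution (w n) a))\<^sup>2) powr \<sigma> \<le> (8 * (1/2) ^ ((n - N) + (N - n))) powr \<sigma>"
          using \<sigma> one_minus_square_le(2)[OF norm_ge_zero na] by (intro powr_mono2) auto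
        also have "\<dots> = 8 powr \<sigma> * ((1/2) powr real ((n - N) + (N - n))) powr \<sigma>"
          by (simp add: powr_mult powr_realpow del: of_nat_add)
        also have "((1/2) powr real ((n - N) + (N - n))) powr \<sigma> = (d n)\<^sup>2"
        proof -
          have "((1/2) powr real j) powr \<sigma> = (\<theta> ^ j)\<^sup>2" for j
          proof -
            have "(\<theta> ^ j)\<^sup>2 = (\<theta> powr real j) powr 2"
              using \<theta> by (simp add: powr_realpow powr_numeral)
            then show ?thesis by (simp add: \<theta>_def powr_powr mult_ac)
          qed
          then show ?thesis by (simp only: d_def)
        qed
        finally show "C * (1 - (norm (disc_involution (w n) a))\<^sup>2) powr \<sigma> \<le> C' * (d n)\<^sup>2"
          using C(1) by (simp add: C'_def mult.assoc)
      qed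
      finally show ?thesis .
    qed
    define S where "S m z = (\<Sum>n<m. bump_deriv (w n) z)" for m z
    have [measurable]: "S m \<in> borel_measurable borel" for m unfolding S_def by measurable
    have partial: "(\<integral>\<^sup>+z\<in>unit_disc. ennreal ((norm (S m z))\<^sup>2 * Green z a powr s) \<partial>lborel) \<le> ennreal (D * (C' * D))" for m
    proof -
      have "(\<integral>\<^sup>+z\<in>unit_disc. ennreal ((norm (S m z))\<^sup>2 * Green z a powr s) \<partial>lborel)
         \<le> (\<integral>\<^sup>+z. (\<Sum>n<m. ennreal (D / d n) * (ennreal ((norm (bump_deriv (w n) z))\<^sup>2 * Green z a powr s) * indicator unit_disc z)) \<partial>lborel)"
      proof (rule nn_integral_mono)
        fix z
        have "(norm (S m z))\<^sup>2 \<le> (\<Sum>n<m. d n) * (\<Sum>n<m. (norm (bump_deriv (w n) z))\<^sup>2 / d n)"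
          unfolding S_def by (intro norm_sum_square_le_weighted d)
        also have "\<dots> \<le> D * (\<Sum>n<m. (norm (bump_deriv (w n) z))\<^sup>2 / d n)"
          by (intro mult_right_mono sd sum_nonneg divide_nonneg_pos d) auto
        finally have "(norm (S m z))\<^sup>2 * Green z a powr s
            \<le> (D * (\<Sum>n<m. (norm (bump_deriv (w n) z))\<^sup>2 / d n)) * Green z a powr s"
          by (intro mult_right_mono) auto
        also have "\<dots> = (\<Sum>n<m. D / d n * ((norm (bump_deriv (w n) z))\<^sup>2 * Green z a powr s))"
          by (simp add: sum_distrib_left sum_distrib_right mult_ac)
        finally have "ennreal ((norm (S m z))\<^sup>2 * Green z a powr s)
            \<le> ennreal (\<Sum>n<m. D / d n * ((norm (bump_deriv (w n) z))\<^sup>2 * Green z a powr s))"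
          by (rule ennreal_leI)
        also have "\<dots> = (\<Sum>n<m. ennreal (D / d n) * ennreal ((norm (bump_deriv (w n) z))\<^sup>2 * Green z a powr s))"
        proof -
          have pos: "0 \<le> D / d n" for n using D d[of n] by simp
          show ?thesis
            unfolding ennreal_mult'[OF pos, symmetric]
            using pos by (intro sum_ennreal[symmetric] mult_nonneg_nonneg) auto
        qed
        finally show "ennreal ((norm (S m z))\<^sup>2 * Green z a powr s) * indicator unit_disc z
          \<le> (\<Sum>n<m. ennreal (D / d n) * (ennreal ((norm (bump_deriv (w n) z))\<^sup>2 * Green z a powr s) * indicator unit_disc z))"
          by (auto simp: indicator_def)
      qed
      also have "\<dots> = (\<Sum>n<m. ennreal (D / d n) *
          (\<integral>\<^sup>+z\<in>unit_disc. ennreal ((norm (bump_deriv (w n) z))\<^sup>2 * Green z a powr s) \<partial>lborel))"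
        by (subst nn_integral_sum) (auto simp: nn_integral_cmult)
      also have "\<dots> \<le> (\<Sum>n<m. ennreal (D / d n) * ennreal (C' * (d n)\<^sup>2))"
        by (intro sum_mono mult_left_mono E) auto
      also have "\<dots> = ennreal (\<Sum>n<m. D * C' * d n)"
      proof -
        have "ennreal (D / d n) * ennreal (C' * (d n)\<^sup>2) = ennreal (D * C' * d n)" for n
          using D C' d[of n] by (simp add: ennreal_mult[symmetric] power2_eq_square)
        then show ?thesis using D C' d by (simp add: sum_ennreal less_imp_le)
      qed
      also have "\<dots> \<le> ennreal (D * (C' * D))"
        using sd[of m] D C' by (intro ennreal_leI) (simp add: sum_distrib_left[symmetric] mult_left_mono mult.assoc)
      finally show ?thesis .
    qed
    let ?f = "\<lambda>m z. ennreal ((norm (S m z))\<^sup>2 * Green z a powr s) * indicator unit_disc z"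
    have "(\<integral>\<^sup>+z\<in>unit_disc. ennreal ((norm (deriv bump_series z))\<^sup>2 * Green z a powr s) \<partial>lborel)
        = (\<integral>\<^sup>+z. liminf (\<lambda>m. ?f m z) \<partial>lborel)"
    proof (rule nn_integral_cong)
      fix z
      show "ennreal ((norm (deriv bump_series z))\<^sup>2 * Green z a powr s) * indicator unit_disc z = liminf (\<lambda>m. ?f m z)"
      proof (cases "norm z < 1")
        case True
        have "(\<lambda>m. S m z) \<longlonglongrightarrow> deriv bump_series z"
          unfolding S_def deriv_bump_series[OF True] by (rule summable_LIMSEQ[OF bump_series_props(2)[OF True]])
        then have "(\<lambda>m. ennreal ((norm (S m z))\<^sup>2 * Green z a powr s)) \<longlonglongrightarrow> ennreal ((norm (deriv bump_series z))\<^sup>2 * Green z a powr s)"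
          by (intro tendsto_intros)
        then have "liminf (\<lambda>m. ennreal ((norm (S m z))\<^sup>2 * Green z a powr s)) = ennreal ((norm (deriv bump_series z))\<^sup>2 * Green z a powr s)"
          by (intro lim_imp_Liminf) auto
        then show ?thesis using True by simp
      qed (simp add: Liminf_const)
    qed
    also have "\<dots> \<le> liminf (\<lambda>m. \<integral>\<^sup>+z. ?f m z \<partial>lborel)"
      by (intro nn_integral_liminf) measurable
    also have "\<dots> \<le> limsup (\<lambda>m. \<integral>\<^sup>+z. ?f m z \<partial>lborel)"
      by (intro Liminf_le_Limsup) auto
    also have "\<dots> \<le> ennreal (D * (C' * D))"
      using partial by (intro Limsup_bounded always_eventually allI) auto
    finally show "(\<integral>\<^sup>+z\<in>unit_disc. ennreal ((norm (deriv bump_series z))\<^sup>2 * Green z a powr s) \<partial>lborel)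
      \<le> ennreal (D * (C' * D))" .
  qed
qed

text \<open>The n summands before the n-th contribute at most 2 each, and those from the n-th on
  form a geometric series with sum at most 4. The linear growth is absorbed by the tolerance in
  \<open>sparse_sequence_exists\<close>.\<close>

lemma norm_bump_series_le: "norm (bump_series (w n)) \<le> 2 * real n + 4"
  unfolding bump_series_def
proof (rule norm_suminf_le_bound)
  show "summable (\<lambda>k. bump (w k) (w n))" by (rule bump_series_props(1)[OF in_disc])
  fix m
  have b: "norm (bump (w k) (w n)) \<le> 2 * (1/2) ^ (k - n)" for k
  proof (cases "k \<le> n")
    case True
    then show ?thesis using norm_bump_le(1)[OF in_disc in_disc] by simp
  next
    case False
    then have "t k \<le> t n * (1/64) ^ (k - n)" using t_add_le[of n "k - n"] by simp
    also have "\<dots> \<le> t n * (1/2) ^ (k - n)"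
      using t_pos[of n] by (intro mult_left_mono power_mono) auto
    finally have "t k / t n \<le> (1/2) ^ (k - n)" using t_pos[of n] by (simp add: field_simps)
    then show ?thesis using norm_bump_le(2)[OF in_disc in_disc, of k n] by linarith
  qed
  have "(\<Sum>k<m. norm (bump (w k) (w n))) \<le> (\<Sum>k<m. 2 * (1/2) ^ (k - n))"
    by (intro sum_mono b)
  also have "\<dots> \<le> (\<Sum>k\<in>{..<n} \<union> {n..<n + m}. 2 * (1/2) ^ (k - n))"
    by (intro sum_mono2) auto
  also have "\<dots> = (\<Sum>k<n. 2 * (1/2) ^ (k - n)) + (\<Sum>k\<in>{n..<n + m}. 2 * (1/2) ^ (k - n))"
    by (intro sum.union_disjoint) auto
  also have "(\<Sum>k<n. 2 * (1/2) ^ (k - n) :: real) = 2 * real n" by simp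
  also have "(\<Sum>k\<in>{n..<n + m}. 2 * (1/2) ^ (k - n)) = 2 * (\<Sum>k<m. (1/2 :: real) ^ k)"
    by (subst sum.atLeastLessThan_shift_0) (auto simp: atLeast0LessThan sum_distrib_left)
  also have "(\<Sum>k<m. (1/2 :: real) ^ k) \<le> 2"
    using sum_le_suminf[of "\<lambda>n. (1/2 :: real) ^ n" "{..<m}"] suminf_geometric[of "1/2 :: real"]
      summable_geometric[of "1/2 :: real"] by simp
  finally show "(\<Sum>k<m. norm (bump (w k) (w n))) \<le> 2 * real n + 4" by simp
qed

text \<open>The diagonal summand equals 1 / (1 - |w n|^2) \<ge> 1 / (2 t n), while all others
  together are at most 1 / (4 t n).\<close>

lemma norm_deriv_bump_series_ge: "1 / 4 \<le> t n * norm (deriv bump_series (w n))"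
proof -
  define y where "y k = (if k = n then 0 else bump_deriv (w k) (w n))" for k
  have sums: "(\<lambda>k. bump_deriv (w k) (w n)) sums deriv bump_series (w n)"
    unfolding deriv_bump_series[OF in_disc] by (rule summable_sums[OF bump_series_props(2)[OF in_disc]])
  have "(\<lambda>k. bump_deriv (w k) (w n) - (if k = n then bump_deriv (w n) (w n) else 0))
      sums (deriv bump_series (w n) - bump_deriv (w n) (w n))"
    by (intro sums_diff sums sums_single)
  also have "(\<lambda>k. bump_deriv (w k) (w n) - (if k = n then bump_deriv (w n) (w n) else 0)) = y"
    by (auto simp: y_def)
  finally have ys: "y sums (deriv bump_series (w n) - bump_deriv (w n) (w n))" .
  have yb: "norm (y k) \<le> 1 / (16 * t n) * (1/2) ^ ((k - n) + (n - k))" for k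
  proof (cases "k = n")
    case False
    define j where "j = (k - n) + (n - k)"
    have j: "1 \<le> j" using False by (simp add: j_def)
    have p: "0 < t k" "0 < t n" using t_pos by auto
    have "norm (y k) \<le> 2 * t k / (max (t k) (t n))\<^sup>2"
      using False norm_bump_deriv_le[OF in_disc in_disc] by (simp add: y_def)
    also have "\<dots> = 2 / t n * (t k * t n / (max (t k) (t n))\<^sup>2)" using p by simp
    also have "t k * t n / (max (t k) (t n))\<^sup>2 = min (t k / t n) (t n / t k)"
      by (rule mult_divide_max_square[OF p])
    also have "\<dots> \<le> (1/64) ^ j" unfolding j_def by (rule min_ratio_le)
    \<comment> \<open>Since j \<ge> 1, the factor (1/32)^j yields the small constant 1/32, and
      (1/2)^j is kept for the summation over k.\<close>
    also have "\<dots> = (1/32) ^ j * (1/2) ^ j" by (simp flip: power_mult_distrib)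
    also have "\<dots> \<le> (1/32) * (1/2) ^ j"
      using power_decreasing[OF j, of "1/32 :: real"] by (intro mult_right_mono) auto
    finally have "norm (y k) \<le> 2 / t n * ((1/32) * (1/2) ^ j)"
      using p by (simp add: divide_right_mono)
    also have "2 / x * ((1/32) * u) = 1 / (16 * x) * u" for x u :: real by simp
    finally show ?thesis by (simp only: j_def)
  qed (use t_pos[of n] in \<open>auto simp: y_def\<close>)
  have "norm (suminf y) \<le> 1 / (16 * t n) * 4"
  proof (rule norm_suminf_le_bound)
    show "summable y" using ys by (rule sums_summable)
    fix m
    have "(\<Sum>k<m. norm (y k)) \<le> (\<Sum>k<m. 1 / (16 * t n) * (1/2) ^ ((k - n) + (n - k)))"
      by (intro sum_mono yb)
    also have "\<dots> = 1 / (16 * t n) * (\<Sum>k<m. (1/2) ^ ((k - n) + (n - k)))"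
      by (simp add: sum_distrib_left)
    also have "\<dots> \<le> 1 / (16 * t n) * 4"
      using t_pos[of n] sum_power_dist_le[of "1/2" n m] by (intro mult_left_mono) auto
    finally show "(\<Sum>k<m. norm (y k)) \<le> 1 / (16 * t n) * 4" .
  qed
  also have "1 / (16 * x) * 4 = 1 / (4 * x)" for x :: real by simp
  finally have 1: "norm (deriv bump_series (w n) - bump_deriv (w n) (w n)) \<le> 1 / (4 * t n)"
    using sums_unique[OF ys] by simp
  have "cnj (w n) * w n = of_real ((norm (w n))\<^sup>2)"
    by (simp add: complex_norm_square mult.commute flip: of_real_power)
  then have "bump_deriv (w n) (w n) = of_real ((1 - (norm (w n))\<^sup>2) / (1 - (norm (w n))\<^sup>2)\<^sup>2)"
    by (simp add: bump_deriv_def)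
  also have "(1 - (norm (w n))\<^sup>2) / (1 - (norm (w n))\<^sup>2)\<^sup>2 = 1 / (1 - (norm (w n))\<^sup>2)"
    by (simp add: power2_eq_square)
  finally have "norm (bump_deriv (w n) (w n)) = 1 / (1 - (norm (w n))\<^sup>2)"
    using one_minus_square_le(2)[OF norm_ge_zero in_disc, of n] by (simp add: norm_divide del: of_real_divide)
  moreover have "1 / (2 * t n) \<le> 1 / (1 - (norm (w n))\<^sup>2)"
    using one_minus_square_le[OF norm_ge_zero in_disc, of n] t_pos[of n] by (intro frac_le) auto
  ultimately have "1 / (2 * t n) - 1 / (4 * t n) \<le> norm (deriv bump_series (w n))"
    using 1 norm_triangle_ineq3[of "bump_deriv (w n) (w n)" "deriv bump_series (w n)"]
    by (simp add: norm_minus_commute)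
  then have "t n * (1 / (2 * t n) - 1 / (4 * t n)) \<le> t n * norm (deriv bump_series (w n))"
    using t_pos[of n] by (intro mult_left_mono) auto
  also have "x * (1 / (2 * x) - 1 / (4 * x)) = 1 / 4" if "0 < x" for x :: real
    using that by (simp add: right_diff_distrib)
  note this[OF t_pos]
  finally show ?thesis .
qed

end

lemma const_in_Q_space: "(\<lambda>_. c) \<in> Q_space s"
  by (rule Q_spaceI[of _ s 0]) auto

subsection \<open>Multipliers\<close>

text \<open>Maximum modulus on a closed disc of radius r that contains z0: a maximum point of |g| on
  the boundary circle serves as z, and r may be taken arbitrarily close to 1.\<close>

lemma nonzero_holomorphic_lower_bound:
  assumes g: "g holomorphic_on unit_disc" and z0: "norm z0 < 1" and \<rho>: "\<rho> < 1"
  shows "\<exists>z. \<rho> < norm z \<and> norm z < 1 \<and> norm (g z0) \<le> norm (g z)"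
proof -
  obtain r where r: "max 0 (max \<rho> (norm z0)) < r" "r < 1" using dense[of "max 0 (max \<rho> (norm z0))" 1] z0 \<rho> by auto
  have cont: "continuous_on (cball 0 r) g"
    using g r by (intro holomorphic_on_imp_continuous_on) (auto intro: holomorphic_on_subset)
  have "sphere (0::complex) r \<noteq> {}" using r by simp
  moreover have "continuous_on (sphere 0 r) (\<lambda>z. norm (g z))"
    using cont by (intro continuous_on_norm) (auto intro: continuous_on_subset)
  ultimately obtain z where z: "z \<in> sphere 0 r" "\<And>u. u \<in> sphere 0 r \<Longrightarrow> norm (g u) \<le> norm (g z)"
    using continuous_attains_sup[OF compact_sphere] by blast
  have "norm (g z0) \<le> norm (g z)"
  proof (rule maximum_modulus_frontier[of g "cball 0 r"])
    show "g holomorphic_on interior (cball 0 r)"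
      using g r by (auto intro: holomorphic_on_subset)
  qed (use cont r z in auto)
  then show ?thesis using z r by (intro exI[of _ z]) auto
qed

text \<open>Each requirement on w n is met by some point sufficiently close to the circle, so the
  points can be chosen recursively. The bound 2n + 4 on the series holds for every sparse sequence,
  hence the tolerance \<epsilon> / (2n + 4) can be fixed before the sequence is known.\<close>

lemma sparse_sequence_exists:
  assumes g: "g holomorphic_on unit_disc" and z0: "norm z0 < 1" and \<epsilon>: "0 < \<epsilon>"
    and dec: "\<And>\<epsilon>. 0 < \<epsilon> \<Longrightarrow> \<exists>\<rho><1. \<forall>z. \<rho> < norm z \<and> norm z < 1 \<longrightarrow> (1 - norm z) * norm (deriv g z) < \<epsilon>"
  shows "\<exists>w. sparse_sequence w \<and> (\<forall>n. norm (g z0) \<le> norm (g (w n)) \<and>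
     (1 - norm (w n)) * norm (deriv g (w n)) < \<epsilon> / (2 * real n + 4))"
proof -
  let ?P = "\<lambda>n x. norm x < 1 \<and> norm (g z0) \<le> norm (g x) \<and>
     (1 - norm x) * norm (deriv g x) < \<epsilon> / (2 * real n + 4)"
  let ?Q = "\<lambda>n x y. 1 - norm y \<le> (1 - norm x) / 64"
  have step: "\<exists>y. ?P n y \<and> 1 - norm y \<le> \<delta>" if \<delta>: "0 < \<delta>" for n \<delta>
  proof -
    have "0 < \<epsilon> / (2 * real n + 4)" using \<epsilon> by (intro divide_pos_pos) auto
    from dec[OF this] obtain \<rho> where \<rho>: "\<rho> < 1" "\<And>z. \<rho> < norm z \<Longrightarrow> norm z < 1 \<Longrightarrow>
      (1 - norm z) * norm (deriv g z) < \<epsilon> / (2 * real n + 4)" by auto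
    obtain y where "max \<rho> (1 - \<delta>) < norm y" "norm y < 1" "norm (g z0) \<le> norm (g y)"
      using nonzero_holomorphic_lower_bound[OF g z0, of "max \<rho> (1 - \<delta>)"] \<rho> \<delta> by auto
    then show ?thesis using \<rho>(2)[of y] by (intro exI[of _ y]) auto
  qed
  have "\<exists>w. \<forall>n. ?P n (w n) \<and> ?Q n (w n) (w (Suc n))"
  proof (rule dependent_nat_choice)
    show "\<exists>x. ?P 0 x" using step[of 1 0] by auto
    show "\<exists>y. ?P (Suc n) y \<and> ?Q n x y" if "?P n x" for x n
      using step[of "(1 - norm x) / 64" "Suc n"] that by simp
  qed
  then obtain w where "\<And>n. ?P n (w n)" "\<And>n. ?Q n (w n) (w (Suc n))" by blast
  then show ?thesis by (intro exI[of _ w]) (auto simp: sparse_sequence_def)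
qed

lemma zero_mult_in_Besov:
  assumes p: "1 \<le> p" and g: "\<forall>z\<in>unit_disc. g z = 0"
  shows "mult_op g f \<in> Besov p"
proof -
  define h where "h = mult_op g f"
  have h0: "h z = 0" if "z \<in> unit_disc" for z using g that by (simp add: h_def mult_op_def)
  have hol: "h holomorphic_on unit_disc"
    by (rule holomorphic_transform[OF holomorphic_on_const[of 0]]) (simp add: h0)
  have d1: "deriv h z = 0" if "z \<in> unit_disc" for z
    using complex_derivative_transform_within_open[of h unit_disc "\<lambda>_. 0" z] hol h0 that by auto
  have d2: "deriv (deriv h) z = 0" if "z \<in> unit_disc" for z
    using complex_derivative_transform_within_open[of "deriv h" unit_disc "\<lambda>_. 0" z]
      holomorphic_deriv[OF hol] d1 that by auto
  have i1: "(\<integral>\<^sup>+ z\<in>unit_disc. ennreal (norm (deriv (deriv h) z)) \<partial>disc_area) = (\<integral>\<^sup>+ z. 0 \<partial>disc_area)"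
    by (intro nn_integral_cong) (auto simp: indicator_def d2)
  have i2: "(\<integral>\<^sup>+ z\<in>unit_disc. ennreal ((1 - norm z) powr (p - 2) * norm (deriv h z) powr p) \<partial>disc_area)
     = (\<integral>\<^sup>+ z. 0 \<partial>disc_area)"
    by (intro nn_integral_cong) (auto simp: indicator_def d1)
  have "h \<in> Besov p" unfolding Besov_def using hol by (simp add: i1 i2)
  then show ?thesis by (simp add: h_def)
qed

theorem theorem2p7:
  fixes s p :: real and g :: "complex \<Rightarrow> complex"
  assumes "0 < s" and "1 \<le> p" and "g holomorphic_on unit_disc"
  shows "mult_op g ` Q_space s \<subseteq> Besov p \<longleftrightarrow> (\<forall>z\<in>unit_disc. g z = 0)"
proof
  assume "\<forall>z\<in>unit_disc. g z = 0"
  then show "mult_op g ` Q_space s \<subseteq> Besov p" using zero_mult_in_Besov assms(2) by blast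
next
  assume sub: "mult_op g ` Q_space s \<subseteq> Besov p"
  show "\<forall>z\<in>unit_disc. g z = 0"
  proof (rule ccontr)
    assume "\<not> ?thesis"
    then obtain z0 where z0: "norm z0 < 1" "g z0 \<noteq> 0" by auto
    define c where "c = norm (g z0)"
    have c: "0 < c" using z0 by (simp add: c_def)
    have "mult_op g (\<lambda>_. 1) \<in> Besov p" using sub const_in_Q_space by blast
    then have "g \<in> Besov p" by (simp add: mult_op_def)
    \<comment> \<open>Two error terms of size c/8 will add up to c/4, the lower bound that the main
      term attains at w n.\<close>
    from sparse_sequence_exists[OF assms(3) z0(1) _ Besov_decay[OF assms(2) this], of "c / 8"] c
    obtain w where sw: "sparse_sequence w" and w: "\<And>n. c \<le> norm (g (w n))"
      "\<And>n. (1 - norm (w n)) * norm (deriv g (w n)) < c / 8 / (2 * real n + 4)"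
      unfolding c_def by auto
    interpret sparse_sequence w by (rule sw)
    have "mult_op g bump_series \<in> Besov p" using sub bump_series_in_Q_space[OF assms(1)] by blast
    from Besov_decay[OF assms(2) this, of "c / 8"] c
    obtain \<rho> where \<rho>: "\<rho> < 1"
      "\<And>z. \<rho> < norm z \<Longrightarrow> norm z < 1 \<Longrightarrow> (1 - norm z) * norm (deriv (mult_op g bump_series) z) < c / 8"
      by auto
    \<comment> \<open>An index with w n beyond the radius \<rho> exists because 1 - |w n| \<le>
      64^(-n).\<close>
    obtain n where "(1/64) ^ n < 1 - \<rho>" using real_arch_pow_inv[of "1 - \<rho>" "1/64"] \<rho> by auto
    then have n: "\<rho> < norm (w n)" using t_le[of n] by linarith
    have "deriv (mult_op g bump_series) (w n) = g (w n) * deriv bump_series (w n) + deriv g (w n) * bump_series (w n)"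
      unfolding mult_op_def
      using in_disc[of n]
      by (intro deriv_mult holomorphic_on_imp_differentiable_at[OF assms(3) open_ball]
          holomorphic_on_imp_differentiable_at[OF holomorphic_bump_series open_ball]) auto
    \<comment> \<open>In the product rule, the term with g' is small by the choice of w and the
      whole derivative is small by Besov decay, which forces the remaining term to be small as
      well.\<close>
    then have "norm (g (w n)) * norm (deriv bump_series (w n))
        \<le> norm (deriv (mult_op g bump_series) (w n)) + norm (deriv g (w n)) * norm (bump_series (w n))"
      using norm_triangle_ineq2[of "deriv (mult_op g bump_series) (w n)" "deriv g (w n) * bump_series (w n)"]
        norm_triangle_ineq4[of "deriv (mult_op g bump_series) (w n)" "deriv g (w n) * bump_series (w n)"]
      by (simp add: norm_mult)
    then have "t n * (norm (g (w n)) * norm (deriv bump_series (w n)))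
        \<le> t n * (norm (deriv (mult_op g bump_series) (w n)) + norm (deriv g (w n)) * norm (bump_series (w n)))"
      using t_pos[of n] by (intro mult_left_mono) auto
    also have "\<dots> = t n * norm (deriv (mult_op g bump_series) (w n)) + t n * norm (deriv g (w n)) * norm (bump_series (w n))"
      by (simp add: algebra_simps)
    also have "\<dots> < c / 8 + c / 8"
    proof (rule add_less_le_mono)
      show "t n * norm (deriv (mult_op g bump_series) (w n)) < c / 8" using \<rho>(2)[OF n in_disc] .
      have "t n * norm (deriv g (w n)) * norm (bump_series (w n)) \<le> c / 8 / (2 * real n + 4) * (2 * real n + 4)"
        using w(2)[of n] norm_bump_series_le[of n] c by (intro mult_mono) auto
      also have "\<dots> = c / 8" by (rule nonzero_eq_divide_eq[THEN iffD1, OF _ refl]) linarith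
      finally show "t n * norm (deriv g (w n)) * norm (bump_series (w n)) \<le> c / 8" .
    qed
    finally have "norm (g (w n)) * (t n * norm (deriv bump_series (w n))) < c / 4" by (simp add: mult_ac)
    moreover have "c * (1 / 4) \<le> norm (g (w n)) * (t n * norm (deriv bump_series (w n)))"
      using w(1) norm_deriv_bump_series_ge c by (intro mult_mono) auto
    ultimately show False by simp
  qed
qed

end
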